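(* Let $A$ be an expansive $d\times d$ integer matrix and let $C=\{\zeta_0,\zeta_1,\dots,\zeta_{p-1}\}\subset\mathbb T^d$ be a cycle, $\zeta_j=e^{2\pi i\theta_j}$, $\theta_j\in\mathbb R^d$. (i) The point $\chi_C$ is periodic for $\sigma_A$, $\sigma_A^p(\chi_C)=\chi_C$, and $\sigma_A$ permutes cyclically the sets $\sigma_A^{-j}(\chi_C)\hat i(\mathbb R^d)$, $j\in\mathbb Z_p$. (ii) The set $\mathcal S_A(C)$ consists of exactly the points $(z_n)_{n\in\mathbb N}\in\mathcal S_A$ with the property that the distance from $z_n$ to $C$ converges to $0$ as $n\to\infty$. (iii) Let $\alpha_{A,p}:\mathbb R^d\times\mathbb Z_p\to\mathbb R^d\times\mathbb Z_p$, $\alpha_{A,p}(x,j)=(A^Tx,j-1)$ for $x\in\mathbb R^d$, $j\in\mathbb Z_p$. The map $\hat i_C:\mathbb R^d\times\mathbb Z_p\to\mathcal S_A(C)$ is a bijective measure preserving transformation (Lebesgue measure times counting measure on $\mathbb R^d\times\mathbb Z_p$, and $\tilde\mu$ on $\mathcal S_A(C)$) that satisfies the relation $$\hat i_C\circ\alpha_{A,p}=\sigma_A\circ\hat i_C.$$ (iv) The operator $\mathcal W_C:\mathcal H_C=L^2(\mathbb R^d\times\mathbb Z_p)\to L^2(\mathcal S_A(C),\tilde\mu)$, $\mathcal W_Cf=f\circ\hat i_C^{-1}$, is an intertwining isometric isomorphism: $$\mathcal W_C\hat T_{C,k}=\tilde T_k\mathcal W_C\quad(k\in\mathbb Z^d),\qquad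 \mathcal W_C\hat U_C=\tilde U\mathcal W_C.$$
   Context: $\mathbb N=\{0,1,2,\dots\}$. An integer matrix $A$ is expansive if all its eigenvalues $\lambda$ satisfy $|\lambda|>1$; $A^T$ is the transpose. For $x\in\mathbb R^d$, $e^{2\pi i x}:=(e^{2\pi i x_1},\dots,e^{2\pi i x_d})\in\mathbb T^d$; for $z=e^{2\pi i x}\in\mathbb T^d$ and $k\in\mathbb Z^d$ put $z^k:=e^{2\pi i k\cdot x}\in\mathbb T$ and $z^A:=e^{2\pi i A^Tx}\in\mathbb T^d$. The solenoid is the compact abelian group $\mathcal S_A=\{(z_n)_{n\in\mathbb N}: z_n\in\mathbb T^d,\ z_{n+1}^A=z_n \text{ for all } n\in\mathbb N\}$ (coordinatewise multiplication, topology induced by the product topology), and $\sigma_A(z_0,z_1,\dots)=(z_0^A,z_0,z_1,\dots)$ is an automorphism of it. $\hat i:\mathbb R^d\to\mathcal S_A$ is $\hat i(x)=(e^{2\pi i(A^T)^{-n}x})_{n\in\mathbb N}$. An ordered set $C=\{\zeta_0,\dots,\zeta_{p-1}\}$ in $\mathbb T^d$ is called a cycle if $\zeta_{j+1}^A=\zeta_j$ for $j\in\{0,\dots,p-2\}$ and $\zeta_0^A=\zeta_{p-1}$, where $p\ge1$. The number $p$ is called the period of the cycle if the points $\zeta_i$ are distinct. Indices of $\zeta,\theta$ are read modulo $p$; $\mathbb Z_p=\{0,\dots,p-1\}$ is the cyclic group of order $p$. Put $\chi_C:=(\zeta_0,\dots,\zeta_{p-1},\zeta_0,\dots,\zeta_{p-1},\dots)\in\mathcal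 S_A$, $$\mathcal S_A(C):=\bigcup_{j=0}^{p-1}\sigma_A^{-j}(\chi_C)\hat i(\mathbb R^d),\qquad \hat i_C(x,j):=\sigma_A^{-j}(\chi_C)\hat i(x)=(e^{2\pi i((A^T)^{-n}x+\theta_{n+j})})_{n\in\mathbb N}.$$ The measure $\tilde\mu$ on $\mathcal S_A(C)$ is defined by $\int_{\mathcal S_A(C)}f\,d\tilde\mu=\int_{\mathbb T^d}\sum_{(z_n)_n\in\mathcal S_A(C),\,z_0=z}f((z_n)_n)\,d\mu(z)$, with $\mu$ the Haar measure on $\mathbb T^d$ (normalized to total mass $1$). On $L^2(\mathcal S_A(C),\tilde\mu)$: $(\tilde T_kf)(z_0,z_1,\dots)=z_0^kf(z_0,z_1,\dots)$ for $k\in\mathbb Z^d$, and $\tilde Uf=\sqrt{|\det A|}\,f\circ\sigma_A$. $\mathcal H_C=L^2(\mathbb R^d)\oplus\dots\oplus L^2(\mathbb R^d)$ ($p$ summands) $=L^2(\mathbb R^d\times\mathbb Z_p)$. On $L^2(\mathbb R^d)$ put $(\hat T_kh)(x)=e^{2\pi ik\cdot x}h(x)$ and $(\hat Uh)(x)=\sqrt{|\det A|}\,h(A^Tx)$ (the Fourier transforms of the translation operator $f\mapsto f(\cdot-k)$ and the dilation operator $f\mapsto|\det A|^{-1/2}f(A^{-1}\cdot)$). On $\mathcal H_C$: $\hat T_{C,k}(h_0,\dots,h_{p-1})=(\zeta_0^k\hat T_kh_0,\dots,\zeta_{p-1}^k\hat T_kh_{p-1})$ and $\hat U_C(h_0,\dots,h_{p-1})=(\hat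 Uh_{p-1},\hat Uh_0,\dots,\hat Uh_{p-2})$.
   Formalization: The bijectivity and measure preservation in (iii), and all of (iv), are stated for cycles whose points ζ_0,…,ζ_{p-1} are distinct; with a repeated point (e.g. p=2, ζ_0=ζ_1) the map î_C is never injective and W_C is undefined. *)

theory Defs
  imports "HOL-Analysis.Analysis"
begin

section \<open>Integer matrices and the torus\<close>

definition real_mat :: "int^'d^'d \<Rightarrow> real^'d^'d" where
  "real_mat A = map_matrix real_of_int A"

text \<open>Eigenvalues are complex eigenvalues.\<close>

definition expansive :: "int^'d^'d \<Rightarrow> bool" where
  "expansive A \<longleftrightarrow>
     (\<forall>l::complex. (\<exists>v::complex^'d. v \<noteq> 0 \<and> map_matrix of_int A *v v = l *s v) \<longrightarrow> cmod l > 1)"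

definition torus :: "(complex^'d) set" where
  "torus = {z. \<forall>i. cmod (z $ i) = 1}"

definition e2pi :: "real^'d \<Rightarrow> complex^'d" where
  "e2pi x = (\<chi> i. cis (2 * pi * x $ i))"

definition int_inner :: "int^'d \<Rightarrow> real^'d \<Rightarrow> real" where
  "int_inner k x = (\<Sum>i\<in>UNIV. of_int (k $ i) * x $ i)"

text \<open>The powers \<open>z\<^sup>k\<close> and \<open>z\<^sup>A\<close> are defined through any \<open>x\<close> with \<open>z = e2pi x\<close>; the choice is
  irrelevant by \<open>torus_pow_e2pi\<close> and \<open>torus_mpow_e2pi\<close> below.\<close>

definition torus_pow :: "complex^'d \<Rightarrow> int^'d \<Rightarrow> complex" where
  "torus_pow z k = (THE w. \<exists>x. z = e2pi x \<and> w = cis (2 * pi * int_inner k x))"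

definition torus_mpow :: "complex^'d \<Rightarrow> int^'d^'d \<Rightarrow> complex^'d" where
  "torus_mpow z A = (THE w. \<exists>x. z = e2pi x \<and> w = e2pi (transpose (real_mat A) *v x))"

lemma e2pi_eqD:
  assumes "e2pi x = e2pi y"
  obtains m :: "int^'d" where "x = y + (\<chi> i. of_int (m $ i))"
proof -
  have "\<exists>n::int. x $ i = y $ i + of_int n" for i
  proof -
    have "cis (2 * pi * x $ i) = cis (2 * pi * y $ i)"
      using assms by (simp add: e2pi_def vec_eq_iff)
    then have "cis (2 * pi * x $ i - 2 * pi * y $ i) = 1"
      by (simp flip: cis_divide)
    then have "cos (2 * pi * x $ i - 2 * pi * y $ i) = 1"
      by (simp add: complex_eq_iff)
    then obtain n :: int where "2 * pi * x $ i - 2 * pi * y $ i = of_int n * 2 * pi"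
      using cos_one_2pi_int by blast
    then have "2 * pi * (x $ i - y $ i - of_int n) = 0"
      by (simp add: algebra_simps)
    then show ?thesis
      by (intro exI[of _ n]) simp
  qed
  then obtain n :: "'d \<Rightarrow> int" where "\<And>i. x $ i = y $ i + of_int (n i)"
    by metis
  then have "x = y + (\<chi> i. of_int ((\<chi> i. n i) $ i))"
    by (simp add: vec_eq_iff)
  then show ?thesis ..
qed

lemma cis_add_int: "cis (2 * pi * (a + of_int n)) = cis (2 * pi * a)"
proof -
  have "cis (2 * pi * (a + of_int n)) = cis (2 * pi * a) * cis (2 * pi * of_int n)"
    by (simp only: cis_mult distrib_left)
  then show ?thesis by simp
qed

lemma torus_pow_e2pi: "torus_pow (e2pi x) k = cis (2 * pi * int_inner k x)"
  unfolding torus_pow_def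
proof (rule the_equality)
  fix w assume "\<exists>y. e2pi x = e2pi y \<and> w = cis (2 * pi * int_inner k y)"
  then obtain y where y: "e2pi x = e2pi y" "w = cis (2 * pi * int_inner k y)" by blast
  obtain m :: "int^'a" where "x = y + (\<chi> i. of_int (m $ i))"
    using e2pi_eqD[OF y(1)] by blast
  then have "int_inner k x = int_inner k y + of_int (\<Sum>i\<in>UNIV. k $ i * m $ i)"
    by (simp add: int_inner_def algebra_simps sum.distrib)
  then show "w = cis (2 * pi * int_inner k x)"
    by (simp only: y(2) cis_add_int)
qed blast

lemma torus_mpow_e2pi: "torus_mpow (e2pi x) A = e2pi (transpose (real_mat A) *v x)"
  unfolding torus_mpow_def
proof (rule the_equality)
  fix w assume "\<exists>y. e2pi x = e2pi y \<and> w = e2pi (transpose (real_mat A) *v y)"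
  then obtain y where y: "e2pi x = e2pi y" "w = e2pi (transpose (real_mat A) *v y)" by blast
  obtain m :: "int^'a" where "x = y + (\<chi> i. of_int (m $ i))"
    using e2pi_eqD[OF y(1)] by blast
  then have "(transpose (real_mat A) *v x) $ i
      = (transpose (real_mat A) *v y) $ i + of_int (\<Sum>j\<in>UNIV. A $ j $ i * m $ j)" for i
    by (simp add: matrix_vector_mult_def transpose_def real_mat_def algebra_simps sum.distrib)
  then show "w = e2pi (transpose (real_mat A) *v x)"
    by (simp only: y(2) e2pi_def cis_add_int)
qed blast

lemma e2pi_in_torus [simp]: "e2pi x \<in> torus"
  by (simp add: torus_def e2pi_def)

lemma e2pi_add: "e2pi (x + y) = e2pi x * e2pi y"
  by (simp add: e2pi_def vec_eq_iff cis_mult distrib_left)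

lemma torus_cases:
  assumes "z \<in> torus"
  obtains x where "z = e2pi x"
proof
  have "cis (Arg (z $ i)) = z $ i" for i
  proof -
    have 1: "cmod (z $ i) = 1"
      using assms by (simp add: torus_def)
    then have "z $ i \<noteq> 0" by auto
    with 1 show ?thesis by (simp add: cis_Arg sgn_eq)
  qed
  then show "z = e2pi (\<chi> i. Arg (z $ i) / (2 * pi))"
    by (simp add: e2pi_def vec_eq_iff)
qed

lemma torus_mpow_in_torus: "z \<in> torus \<Longrightarrow> torus_mpow z A \<in> torus"
  by (metis torus_cases torus_mpow_e2pi e2pi_in_torus)


section \<open>The solenoid\<close>

definition solenoid :: "int^'d^'d \<Rightarrow> (nat \<Rightarrow> complex^'d) set" where
  "solenoid A = {z. (\<forall>n. z n \<in> torus) \<and> (\<forall>n. torus_mpow (z (Suc n)) A = z n)}"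

definition sol_mult :: "(nat \<Rightarrow> complex^'d) \<Rightarrow> (nat \<Rightarrow> complex^'d) \<Rightarrow> nat \<Rightarrow> complex^'d" where
  "sol_mult z w = (\<lambda>n. z n * w n)"

definition sigma_A :: "int^'d^'d \<Rightarrow> (nat \<Rightarrow> complex^'d) \<Rightarrow> nat \<Rightarrow> complex^'d" where
  "sigma_A A z = (\<lambda>n. case n of 0 \<Rightarrow> torus_mpow (z 0) A | Suc m \<Rightarrow> z m)"

definition sigma_inv :: "int^'d^'d \<Rightarrow> (nat \<Rightarrow> complex^'d) \<Rightarrow> nat \<Rightarrow> complex^'d" where
  "sigma_inv A = inv_into (solenoid A) (sigma_A A)"

definition transpose_inv_pow :: "int^'d^'d \<Rightarrow> nat \<Rightarrow> real^'d \<Rightarrow> real^'d" where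
  "transpose_inv_pow A n = ((*v) (matrix_inv (transpose (real_mat A)))) ^^ n"

definition hat_i :: "int^'d^'d \<Rightarrow> real^'d \<Rightarrow> nat \<Rightarrow> complex^'d" where
  "hat_i A x = (\<lambda>n. e2pi (transpose_inv_pow A n x))"

lemma sigma_in_solenoid: "z \<in> solenoid A \<Longrightarrow> sigma_A A z \<in> solenoid A"
  by (auto simp: solenoid_def sigma_A_def torus_mpow_in_torus split: nat.split)

lemma sigma_inv_eq:
  assumes "z \<in> solenoid A"
  shows "sigma_inv A z = (\<lambda>n. z (Suc n))"
  unfolding sigma_inv_def
proof (rule inv_into_f_eq)
  show "inj_on (sigma_A A) (solenoid A)"
  proof (rule inj_onI, rule ext)
    fix v w n assume "sigma_A A v = sigma_A A w"
    then have "sigma_A A v (Suc n) = sigma_A A w (Suc n)" by simp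
    then show "v n = w n" by (simp add: sigma_A_def)
  qed
  show "(\<lambda>n. z (Suc n)) \<in> solenoid A"
    using assms by (simp add: solenoid_def)
  show "sigma_A A (\<lambda>n. z (Suc n)) = z"
    using assms by (auto simp: solenoid_def sigma_A_def split: nat.split)
qed

lemma bij_betw_sigma: "bij_betw (sigma_A A) (solenoid A) (solenoid A)"
proof (rule bij_betw_byWitness[where f' = "\<lambda>z n. z (Suc n)"])
  show "(\<lambda>z n. z (Suc n)) ` solenoid A \<subseteq> solenoid A"
    by (auto simp: solenoid_def)
qed (auto simp: sigma_in_solenoid, auto simp: solenoid_def sigma_A_def split: nat.split)


section \<open>Cycles\<close>

text \<open>The points of a cycle need not be distinct; \<open>p\<close> is the period of the cycle when
  additionally \<open>inj_on \<zeta> {..<p}\<close>. Only the values \<open>\<zeta> j\<close> with \<open>j < p\<close> matter; indices are read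
  modulo \<open>p\<close>, and \<open>{..<p}\<close> stands for the cyclic group of order \<open>p\<close>.\<close>

definition is_cycle :: "int^'d^'d \<Rightarrow> nat \<Rightarrow> (nat \<Rightarrow> complex^'d) \<Rightarrow> bool" where
  "is_cycle A p \<zeta> \<longleftrightarrow> p \<ge> 1 \<and> (\<forall>j<p. \<zeta> j \<in> torus) \<and>
     (\<forall>j. Suc j < p \<longrightarrow> torus_mpow (\<zeta> (Suc j)) A = \<zeta> j) \<and> torus_mpow (\<zeta> 0) A = \<zeta> (p - 1)"

definition pred_mod :: "nat \<Rightarrow> nat \<Rightarrow> nat" where
  "pred_mod p j = (j + p - 1) mod p"

definition chi_C :: "nat \<Rightarrow> (nat \<Rightarrow> complex^'d) \<Rightarrow> nat \<Rightarrow> complex^'d" where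
  "chi_C p \<zeta> = (\<lambda>n. \<zeta> (n mod p))"

definition leaf_C ::
    "int^'d^'d \<Rightarrow> nat \<Rightarrow> (nat \<Rightarrow> complex^'d) \<Rightarrow> nat \<Rightarrow> (nat \<Rightarrow> complex^'d) set" where
  "leaf_C A p \<zeta> j = (\<lambda>x. sol_mult ((sigma_inv A ^^ j) (chi_C p \<zeta>)) (hat_i A x)) ` UNIV"

definition solenoid_C ::
    "int^'d^'d \<Rightarrow> nat \<Rightarrow> (nat \<Rightarrow> complex^'d) \<Rightarrow> (nat \<Rightarrow> complex^'d) set" where
  "solenoid_C A p \<zeta> = (\<Union>j<p. leaf_C A p \<zeta> j)"

definition hat_i_C ::
    "int^'d^'d \<Rightarrow> nat \<Rightarrow> (nat \<Rightarrow> complex^'d) \<Rightarrow> (real^'d) \<times> nat \<Rightarrow> nat \<Rightarrow> complex^'d" where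
  "hat_i_C A p \<zeta> = (\<lambda>(x, j). sol_mult ((sigma_inv A ^^ j) (chi_C p \<zeta>)) (hat_i A x))"

definition alpha :: "int^'d^'d \<Rightarrow> nat \<Rightarrow> (real^'d) \<times> nat \<Rightarrow> (real^'d) \<times> nat" where
  "alpha A p = (\<lambda>(x, j). (transpose (real_mat A) *v x, pred_mod p j))"

lemma chi_C_in_solenoid:
  assumes "is_cycle A p \<zeta>"
  shows "chi_C p \<zeta> \<in> solenoid A"
proof -
  have p: "p \<ge> 1" using assms by (simp add: is_cycle_def)
  have "torus_mpow (\<zeta> (Suc n mod p)) A = \<zeta> (n mod p)" for n
  proof (cases "Suc (n mod p) = p")
    case True
    then have "Suc n mod p = 0" "n mod p = p - 1"
      by (simp_all add: mod_Suc)
    then show ?thesis using assms by (simp add: is_cycle_def)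
  next
    case False
    moreover have "n mod p < p" using p by simp
    ultimately have "Suc n mod p = Suc (n mod p)" "Suc (n mod p) < p"
      by (simp_all add: mod_Suc)
    then show ?thesis using assms by (simp add: is_cycle_def)
  qed
  moreover have "\<zeta> (n mod p) \<in> torus" for n
    using assms p by (simp add: is_cycle_def)
  ultimately show ?thesis
    by (simp add: solenoid_def chi_C_def)
qed

lemma sigma_inv_pow_chi_C:
  assumes "is_cycle A p \<zeta>"
  shows "(sigma_inv A ^^ j) (chi_C p \<zeta>) = (\<lambda>n. \<zeta> ((n + j) mod p))"
proof (induction j)
  case 0
  then show ?case by (simp add: chi_C_def)
next
  case (Suc j)
  have "(\<lambda>n. \<zeta> ((n + j) mod p)) \<in> solenoid A"
    using chi_C_in_solenoid[OF assms] by (simp add: solenoid_def chi_C_def)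
  then show ?case by (simp add: Suc.IH sigma_inv_eq)
qed

lemma hat_i_C_eq:
  assumes "is_cycle A p \<zeta>" and "\<And>j. j < p \<Longrightarrow> \<zeta> j = e2pi (\<theta> j)"
  shows "hat_i_C A p \<zeta> (x, j) = (\<lambda>n. e2pi (transpose_inv_pow A n x + \<theta> ((n + j) mod p)))"
proof -
  have "p > 0" using assms(1) by (simp add: is_cycle_def)
  then show ?thesis
    by (simp add: hat_i_C_def sigma_inv_pow_chi_C[OF assms(1)] sol_mult_def hat_i_def e2pi_add
        assms(2) mult.commute)
qed


section \<open>Measures\<close>

definition haar_torus :: "(complex^'d) measure" where
  "haar_torus = (THE m. sets m = sets (restrict_space borel torus) \<and> emeasure m torus = 1 \<and>
     (\<forall>w\<in>torus. distr m m ((*) w) = m))"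

text \<open>The integral formula defining the measure, evaluated at indicator functions of Borel sets;
  \<open>borel\<close> refers to the product topology. The inner integral against counting measure is the sum
  over the fibre of \<open>z\<close>.\<close>

definition mu_tilde ::
    "int^'d^'d \<Rightarrow> nat \<Rightarrow> (nat \<Rightarrow> complex^'d) \<Rightarrow> (nat \<Rightarrow> complex^'d) measure" where
  "mu_tilde A p \<zeta> = measure_of (solenoid_C A p \<zeta>) (sets (restrict_space borel (solenoid_C A p \<zeta>)))
     (\<lambda>E. \<integral>\<^sup>+z. (\<integral>\<^sup>+s. indicator E s \<partial>count_space {s \<in> solenoid_C A p \<zeta>. s 0 = z}) \<partial>haar_torus)"

definition leb_count :: "nat \<Rightarrow> ((real^'d) \<times> nat) measure" where
  "leb_count p = lborel \<Otimes>\<^sub>M count_space {..<p}"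

text \<open>An isomorphism of measure spaces: the inverse is measurable too.\<close>

definition bij_measure_preserving :: "'a measure \<Rightarrow> 'b measure \<Rightarrow> ('a \<Rightarrow> 'b) \<Rightarrow> bool" where
  "bij_measure_preserving M N f \<longleftrightarrow> bij_betw f (space M) (space N) \<and>
     f \<in> M \<rightarrow>\<^sub>M N \<and> inv_into (space M) f \<in> N \<rightarrow>\<^sub>M M \<and>
     (\<forall>E\<in>sets N. emeasure N E = emeasure M (f -` E \<inter> space M))"


section \<open>The Hilbert space of square-integrable functions modulo null functions\<close>

definition L2_fun :: "'a measure \<Rightarrow> ('a \<Rightarrow> complex) set" where
  "L2_fun M = {f. f \<in> borel_measurable M \<and> integrable M (\<lambda>x. (cmod (f x))\<^sup>2)}"

definition L2_rel :: "'a measure \<Rightarrow> (('a \<Rightarrow> complex) \<times> ('a \<Rightarrow> complex)) set" where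
  "L2_rel M = {(f, g). f \<in> L2_fun M \<and> g \<in> L2_fun M \<and> (AE x in M. f x = g x)}"

definition L2 :: "'a measure \<Rightarrow> ('a \<Rightarrow> complex) set set" where
  "L2 M = L2_fun M // L2_rel M"

definition L2_add ::
    "'a measure \<Rightarrow> ('a \<Rightarrow> complex) set \<Rightarrow> ('a \<Rightarrow> complex) set \<Rightarrow> ('a \<Rightarrow> complex) set" where
  "L2_add M X Y = L2_rel M `` {\<lambda>x. f x + g x | f g. f \<in> X \<and> g \<in> Y}"

definition L2_scale ::
    "'a measure \<Rightarrow> complex \<Rightarrow> ('a \<Rightarrow> complex) set \<Rightarrow> ('a \<Rightarrow> complex) set" where
  "L2_scale M c X = L2_rel M `` {\<lambda>x. c * f x | f. f \<in> X}"

definition L2_norm :: "'a measure \<Rightarrow> ('a \<Rightarrow> complex) set \<Rightarrow> real" where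
  "L2_norm M X = the_elem ((\<lambda>f. sqrt (\<integral>x. (cmod (f x))\<^sup>2 \<partial>M)) ` X)"

text \<open>The operator on classes induced by an operator on functions (into the classes over \<open>N\<close>).\<close>

definition L2_op ::
    "'b measure \<Rightarrow> (('a \<Rightarrow> complex) \<Rightarrow> ('b \<Rightarrow> complex)) \<Rightarrow> ('a \<Rightarrow> complex) set \<Rightarrow> ('b \<Rightarrow> complex) set"
    where
  "L2_op N T X = L2_rel N `` (T ` X)"

definition L2_isometric_iso ::
    "'a measure \<Rightarrow> 'b measure \<Rightarrow> (('a \<Rightarrow> complex) set \<Rightarrow> ('b \<Rightarrow> complex) set) \<Rightarrow> bool" where
  "L2_isometric_iso M N W \<longleftrightarrow> bij_betw W (L2 M) (L2 N) \<and>
     (\<forall>X\<in>L2 M. \<forall>Y\<in>L2 M. W (L2_add M X Y) = L2_add N (W X) (W Y)) \<and>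
     (\<forall>c. \<forall>X\<in>L2 M. W (L2_scale M c X) = L2_scale N c (W X)) \<and>
     (\<forall>X\<in>L2 M. L2_norm N (W X) = L2_norm M X)"


section \<open>The operators\<close>

definition tilde_T ::
    "int^'d \<Rightarrow> ((nat \<Rightarrow> complex^'d) \<Rightarrow> complex) \<Rightarrow> (nat \<Rightarrow> complex^'d) \<Rightarrow> complex" where
  "tilde_T k f = (\<lambda>z. torus_pow (z 0) k * f z)"

definition tilde_U ::
    "int^'d^'d \<Rightarrow> ((nat \<Rightarrow> complex^'d) \<Rightarrow> complex) \<Rightarrow> (nat \<Rightarrow> complex^'d) \<Rightarrow> complex" where
  "tilde_U A f = (\<lambda>z. complex_of_real (sqrt (real_of_int \<bar>det A\<bar>)) * f (sigma_A A z))"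

definition hat_T :: "int^'d \<Rightarrow> (real^'d \<Rightarrow> complex) \<Rightarrow> real^'d \<Rightarrow> complex" where
  "hat_T k h = (\<lambda>x. cis (2 * pi * int_inner k x) * h x)"

definition hat_U :: "int^'d^'d \<Rightarrow> (real^'d \<Rightarrow> complex) \<Rightarrow> real^'d \<Rightarrow> complex" where
  "hat_U A h = (\<lambda>x. complex_of_real (sqrt (real_of_int \<bar>det A\<bar>)) * h (transpose (real_mat A) *v x))"

text \<open>A tuple \<open>(h\<^sub>0, \<dots>, h\<^sub>p\<^sub>-\<^sub>1)\<close> is the function \<open>f\<close> with \<open>f (x, j) = h\<^sub>j x\<close>.\<close>

definition hat_T_C ::
    "(nat \<Rightarrow> complex^'d) \<Rightarrow> int^'d \<Rightarrow> ((real^'d) \<times> nat \<Rightarrow> complex) \<Rightarrow> (real^'d) \<times> nat \<Rightarrow> complex" where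
  "hat_T_C \<zeta> k f = (\<lambda>(x, j). torus_pow (\<zeta> j) k * hat_T k (\<lambda>y. f (y, j)) x)"

definition hat_U_C ::
    "int^'d^'d \<Rightarrow> nat \<Rightarrow> ((real^'d) \<times> nat \<Rightarrow> complex) \<Rightarrow> (real^'d) \<times> nat \<Rightarrow> complex" where
  "hat_U_C A p f = (\<lambda>(x, j). hat_U A (\<lambda>y. f (y, pred_mod p j)) x)"

definition W_C ::
    "int^'d^'d \<Rightarrow> nat \<Rightarrow> (nat \<Rightarrow> complex^'d) \<Rightarrow>
     ((real^'d) \<times> nat \<Rightarrow> complex) \<Rightarrow> (nat \<Rightarrow> complex^'d) \<Rightarrow> complex" where
  "W_C A p \<zeta> f = f \<circ> inv_into (UNIV \<times> {..<p}) (hat_i_C A p \<zeta>)"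

end

theory Submission
  imports Defs "HOL-Computational_Algebra.Fundamental_Theorem_Algebra"
begin

text \<open>Write \<open>B\<close> for the transpose of \<open>A\<close> and \<open>\<iota>(x, j)\<close> for the point of the solenoid whose
  \<open>n\<close>-th coordinate is \<open>e2pi (B\<^sup>-\<^sup>n x) * \<zeta> (n + j)\<close>, the index being read modulo \<open>p\<close>.

  Everything rests on one analytic fact: since \<open>A\<close> is expansive, \<open>B\<^sup>-\<^sup>n x \<rightarrow> 0\<close> for every \<open>x\<close>
  (\<open>transpose_inv_pow_tendsto_zero\<close>). Hence \<open>\<iota>(x, j)\<close> follows the cycle more and more closely.
  Conversely, if the coordinates \<open>z\<^sub>n\<close> of a point of the solenoid approach the finite set \<open>C\<close>,
  write \<open>z\<^sub>n = \<zeta> (k n) * e2pi \<epsilon>\<^sub>n\<close> with \<open>\<epsilon>\<^sub>n \<rightarrow> 0\<close>. Finiteness of \<open>C\<close> forces \<open>\<zeta> (k n)\<close> to run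
  through the cycle from some index on, and discreteness of the integer lattice forces
  \<open>\<epsilon>\<^sub>n = B \<epsilon>\<^sub>n\<^sub>+\<^sub>1\<close> for large \<open>n\<close>. The tail of \<open>z\<close> therefore agrees with that of some
  \<open>\<iota>(x, j)\<close>, and a point of the solenoid is determined by any tail (\<open>asymptotic_imp_\<Omega>\<close>). The
  discreteness of the lattice also makes \<open>\<iota>\<close> injective when the points of the cycle are distinct
  (\<open>inj_on_\<iota>\<close>). The dynamical relations are read off from the coordinates of \<open>\<iota>\<close>.

  For the measure, the fibre over \<open>z\<^sub>0 = e2pi u\<close> consists of the points \<open>\<iota>(u + m - \<theta>\<^sub>j, j)\<close> with \<open>m\<close>
  an integer vector. Summing over \<open>m\<close> and integrating over a unit cube of vectors \<open>u\<close> is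
  integration over the whole space (\<open>nn_integral_tiling\<close>). Since Haar measure on the torus is the
  image of Lebesgue measure on the cube (\<open>haar_torus_eq\<close>), the measure on the solenoid is the
  image of Lebesgue times counting measure under \<open>\<iota>\<close> (\<open>mu_tilde_eq\<close>). The inverse of \<open>\<iota>\<close> is
  Borel because \<open>\<iota>\<close> is continuous on each leaf and the leaves are \<open>\<sigma>\<close>-compact.

  Finally, composition with the inverse of any isomorphism of measure spaces is an isometric
  isomorphism of the \<open>L\<^sup>2\<close> spaces that transports operators
  (\<open>measure_isomorphism.W_intertwines\<close>). It remains to compare the operators pointwise, which is
  \<open>tilde_T_\<iota>\<close> and \<open>tilde_U_\<iota>\<close>, and to see that the operators on the side of the Euclidean space
  act on \<open>L\<^sup>2\<close>; for the dilation this is the change of variables formula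
  \<open>nn_integral_lborel_linear\<close>.\<close>

section \<open>Powers of matrices with eigenvalues inside the unit disc\<close>

lemma perturbed_geometric_tendsto_zero:
  fixes u e :: "nat \<Rightarrow> complex" and l :: complex
  assumes l: "cmod l < 1"
    and rec: "\<And>n. u (Suc n) = l * u n + e n"
    and e: "e \<longlonglongrightarrow> 0"
  shows "u \<longlonglongrightarrow> 0"
proof (rule LIMSEQ_I)
  fix r :: real assume r: "r > 0"
  \<comment> \<open>With this error bound, \<open>r / 2\<close> is the fixed point of \<open>t \<mapsto> \<bar>l\<bar> t + d\<close>.\<close>
  define d where "d = r * (1 - cmod l) / 2"
  have d: "d > 0" using r l by (simp add: d_def)
  obtain N where N: "\<And>n. n \<ge> N \<Longrightarrow> cmod (e n) < d"
    using LIMSEQ_D[OF e d] by auto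
  have bound: "cmod (u (N + m)) \<le> cmod l ^ m * cmod (u N) + r / 2" for m
  proof (induction m)
    case 0
    then show ?case using r by simp
  next
    case (Suc m)
    have "cmod (u (N + Suc m)) \<le> cmod l * cmod (u (N + m)) + cmod (e (N + m))"
      using norm_triangle_ineq[of "l * u (N + m)" "e (N + m)"] by (simp add: rec norm_mult)
    also have "\<dots> \<le> cmod l * (cmod l ^ m * cmod (u N) + r / 2) + d"
      using Suc N[of "N + m"] by (intro add_mono mult_left_mono) auto
    also have "\<dots> = cmod l ^ Suc m * cmod (u N) + r / 2"
      by (simp add: d_def field_simps)
    finally show ?case .
  qed
  have "(\<lambda>m. cmod l ^ m * cmod (u N)) \<longlonglongrightarrow> 0"
    using l by (intro tendsto_mult_left_zero LIMSEQ_power_zero) auto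
  then obtain K where K: "\<And>m. m \<ge> K \<Longrightarrow> cmod l ^ m * cmod (u N) < r / 2"
    using LIMSEQ_D[of _ 0 "r/2"] r by fastforce
  have "norm (u n - 0) < r" if "n \<ge> N + K" for n
  proof -
    have "n - N \<ge> K" "N + (n - N) = n" using that by auto
    then show ?thesis using bound[of "n - N"] K[of "n - N"] by simp
  qed
  then show "\<exists>no. \<forall>n\<ge>no. norm (u n - 0) < r" by blast
qed

definition poly_act :: "complex^'n^'n \<Rightarrow> complex poly \<Rightarrow> complex^'n \<Rightarrow> complex^'n" where
  "poly_act M q v = (\<Sum>i\<le>degree q. coeff q i *s (((*v) M) ^^ i) v)"

lemma poly_act_eq_sum:
  assumes "degree q \<le> N"
  shows "poly_act M q v = (\<Sum>i\<le>N. coeff q i *s (((*v) M) ^^ i) v)"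
  unfolding poly_act_def using assms
  by (intro sum.mono_neutral_left) (auto simp: coeff_eq_0)

lemma funpow_mult_vec_diff:
  fixes M :: "complex^'n^'n"
  shows "(((*v) M) ^^ i) (v - c *s w) = (((*v) M) ^^ i) v - c *s (((*v) M) ^^ i) w"
proof (induction i)
  case 0
  then show ?case by simp
next
  case (Suc i)
  then show ?case by (simp add: matrix_vector_mult_diff_distrib vector_scalar_commute)
qed

lemma poly_act_linear_factor:
  "poly_act M ([:- l, 1:] * r) v = poly_act M r (M *v v - l *s v)"
proof -
  let ?P = "\<lambda>i. (((*v) M) ^^ i)"
  define N where "N = Suc (degree r)"
  have eq: "[:- l, 1:] * r = pCons 0 r - smult l r" by simp
  have "degree ([:- l, 1:] * r) \<le> N"
    unfolding N_def by (rule order_trans[OF degree_mult_le]) auto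
  then have "poly_act M ([:- l, 1:] * r) v
      = (\<Sum>i\<le>N. coeff (pCons 0 r) i *s ?P i v) - (\<Sum>i\<le>N. coeff r i *s (l *s ?P i v))"
    by (simp only: poly_act_eq_sum eq)
       (simp add: sum_subtractf vec.scale_left_diff_distrib mult.commute)
  also have "(\<Sum>i\<le>N. coeff (pCons 0 r) i *s ?P i v) = (\<Sum>i\<le>degree r. coeff r i *s ?P i (M *v v))"
    unfolding N_def by (subst sum.atMost_Suc_shift) (simp add: funpow_swap1[of "(*v) M"])
  also have "\<dots> = (\<Sum>i\<le>N. coeff r i *s ?P i (M *v v))"
    by (simp add: N_def coeff_eq_0)
  also have "\<dots> - (\<Sum>i\<le>N. coeff r i *s (l *s ?P i v)) = poly_act M r (M *v v - l *s v)"
    by (subst poly_act_eq_sum[of r N])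
       (simp_all add: N_def funpow_mult_vec_diff vec.scale_right_diff_distrib sum_subtractf)
  finally show ?thesis .
qed

lemma poly_act_commute:
  "poly_act M r (M *v v - l *s v) = M *v poly_act M r v - l *s poly_act M r v"
proof -
  have "M *v poly_act M r v = (\<Sum>i\<le>degree r. coeff r i *s (((*v) M) ^^ i) (M *v v))"
    by (simp add: poly_act_def vec.linear_sum[OF matrix_vector_mul_linear_gen] vector_scalar_commute
        funpow_swap1[of "(*v) M"])
  then show ?thesis
    by (simp add: poly_act_def funpow_mult_vec_diff vec.scale_right_diff_distrib sum_subtractf
        vec.scale_sum_right mult.commute)
qed

text \<open>The vectors \<open>v, M v, M\<^sup>2 v, \<dots>\<close> live in a finite-dimensional space, so they satisfy a linear
  relation, and real coefficients suffice. If two of the vectors coincide, the relation says so.\<close>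

lemma exists_annihilating_poly:
  fixes v :: "complex^'n"
  obtains q where "q \<noteq> 0" "poly_act M q v = 0"
proof -
  let ?P = "\<lambda>i. (((*v) M) ^^ i) v"
  let ?n = "DIM(complex^'n)"
  show thesis
  proof (cases "inj_on ?P {..?n}")
    case True
    then have card: "card (?P ` {..?n}) = Suc ?n"
      by (simp add: card_image)
    then have "dependent (?P ` {..?n})"
      by (intro dependent_biggerset) simp
    then obtain c where c: "\<exists>w\<in>?P ` {..?n}. c w \<noteq> 0" "(\<Sum>w\<in>?P ` {..?n}. c w *\<^sub>R w) = 0"
      by (auto simp: dependent_finite)
    define q where "q = (\<Sum>i\<le>?n. monom (complex_of_real (c (?P i))) i)"
    have coeff: "coeff q i = (if i \<le> ?n then complex_of_real (c (?P i)) else 0)" for i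
      by (simp add: q_def coeff_sum)
    have "poly_act M q v = (\<Sum>i\<le>?n. complex_of_real (c (?P i)) *s ?P i)"
      by (subst poly_act_eq_sum[of _ ?n]) (auto simp: coeff intro: degree_le)
    also have "\<dots> = (\<Sum>i\<le>?n. c (?P i) *\<^sub>R ?P i)"
      by (intro sum.cong refl) (simp add: vec_eq_iff scaleR_conv_of_real[where 'a = complex])
    also have "\<dots> = 0"
      using c(2) by (subst (asm) sum.reindex[OF True]) (simp add: o_def)
    finally have "poly_act M q v = 0" .
    moreover from c(1) obtain i where "i \<le> ?n" "coeff q i \<noteq> 0"
      by (auto simp: coeff)
    then have "q \<noteq> 0" by auto
    ultimately show thesis using that by blast
  next
    case False
    then obtain i j where ij: "i \<noteq> j" "?P i = ?P j" by (auto simp: inj_on_def)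
    define q where "q = monom (1 :: complex) i - monom 1 j"
    have "coeff q i = 1" using ij by (simp add: q_def)
    then have "q \<noteq> 0" by auto
    moreover have "degree q \<le> max i j"
      unfolding q_def by (intro degree_diff_le) (simp_all add: degree_monom_eq)
    then have "poly_act M q v = (\<Sum>k\<le>max i j. (if k = i then ?P k else 0) - (if k = j then ?P k else 0))"
      by (subst poly_act_eq_sum) (auto simp: q_def intro!: sum.cong)
    then have "poly_act M q v = 0"
      using ij by (simp add: sum_subtractf)
    ultimately show thesis using that by blast
  qed
qed

text \<open>Split off one root \<open>l\<close> of \<open>q\<close> at a time. If \<open>\<bar>l\<bar> < 1\<close>, the powers on \<open>w = M v - l v\<close> tend to
  zero by induction, and \<open>M\<^sup>n\<^sup>+\<^sup>1 v = l M\<^sup>n v + M\<^sup>n w\<close> is a perturbed geometric recursion. Otherwise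
  \<open>M - l\<close> is injective, so the remaining factor already annihilates \<open>v\<close>.\<close>

lemma annihilated_powers_tendsto_zero:
  fixes M :: "complex^'n^'n"
  assumes eig: "\<And>l w. cmod l \<ge> 1 \<Longrightarrow> M *v w = l *s w \<Longrightarrow> w = 0"
    and "q \<noteq> 0" "poly_act M q v = 0"
  shows "(\<lambda>n. (((*v) M) ^^ n) v) \<longlonglongrightarrow> 0"
  using assms(2,3)
proof (induction "degree q" arbitrary: q v)
  case 0
  then obtain c where q: "q = [:c:]" "c \<noteq> 0"
    by (metis degree_eq_zeroE pCons_0_0)
  then have "v = 0"
    using 0(3) by (simp add: poly_act_def)
  have "(((*v) M) ^^ n) (0 :: complex^'n) = 0" for n
    by (induction n) auto
  then show ?case using \<open>v = 0\<close> by simp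
next
  case (Suc k)
  have "\<not> constant (poly q)"
    using Suc(2) by (simp add: constant_degree)
  then obtain l where "poly q l = 0"
    using fundamental_theorem_of_algebra by blast
  then obtain r where r: "q = [:- l, 1:] * r"
    by (auto simp: poly_eq_0_iff_dvd)
  with \<open>q \<noteq> 0\<close> have "r \<noteq> 0" by auto
  with r Suc(2) have deg: "k = degree r"
    by (simp del: mult_pCons_left add: degree_mult_eq)
  have w: "poly_act M r (M *v v - l *s v) = 0"
    using Suc.prems(2) by (simp only: r poly_act_linear_factor)
  show ?case
  proof (cases "cmod l < 1")
    case True
    have lim: "(\<lambda>n. (((*v) M) ^^ n) (M *v v - l *s v)) \<longlonglongrightarrow> 0"
      by (rule Suc.hyps(1)[OF deg \<open>r \<noteq> 0\<close> w])
    show ?thesis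
    proof (rule vec_tendstoI)
      fix i
      show "(\<lambda>n. (((*v) M) ^^ n) v $ i) \<longlonglongrightarrow> (0 :: complex^'n) $ i"
        unfolding zero_index
      proof (rule perturbed_geometric_tendsto_zero[OF True])
        show "(\<lambda>n. (((*v) M) ^^ n) (M *v v - l *s v) $ i) \<longlonglongrightarrow> 0"
          using tendsto_vec_nth[OF lim, of i] by simp
        show "(((*v) M) ^^ Suc n) v $ i
            = l * (((*v) M) ^^ n) v $ i + (((*v) M) ^^ n) (M *v v - l *s v) $ i" for n
          by (simp add: funpow_mult_vec_diff funpow_swap1[of "(*v) M"])
      qed
    qed
  next
    case False
    have "poly_act M r v = 0"
      using w False eig[of l "poly_act M r v"] by (simp add: poly_act_commute)
    then show ?thesis
      by (rule Suc.hyps(1)[OF deg \<open>r \<noteq> 0\<close>])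
  qed
qed

lemma matrix_powers_tendsto_zero:
  fixes M :: "complex^'n^'n"
  assumes "\<And>l w. cmod l \<ge> 1 \<Longrightarrow> M *v w = l *s w \<Longrightarrow> w = 0"
  shows "(\<lambda>n. (((*v) M) ^^ n) v) \<longlonglongrightarrow> 0"
proof -
  obtain q where "q \<noteq> 0" "poly_act M q v = 0"
    by (rule exists_annihilating_poly)
  with assms show ?thesis
    by (rule annihilated_powers_tendsto_zero)
qed

section \<open>The dual matrix of an expansive matrix\<close>

abbreviation dual_mat :: "int^'d^'d \<Rightarrow> real^'d^'d" where
  "dual_mat A \<equiv> transpose (real_mat A)"

definition cvec :: "real^'n \<Rightarrow> complex^'n" where
  "cvec x = (\<chi> i. complex_of_real (x $ i))"

lemma cvec_mult: "map_matrix complex_of_real N *v cvec x = cvec (N *v x)"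
  by (simp add: cvec_def vec_eq_iff matrix_vector_mult_def)

lemma cvec_eq_0: "cvec x = 0 \<longleftrightarrow> x = 0"
  by (simp add: cvec_def vec_eq_iff)

text \<open>A matrix \<open>M - l\<close> and its transpose have the same determinant, so they are singular together.\<close>

lemma eigenvalue_transpose:
  fixes M :: "complex^'n^'n"
  assumes "transpose M *v w = l *s w" "w \<noteq> 0"
  obtains v where "v \<noteq> 0" "M *v v = l *s v"
proof -
  have sub: "(N - mat l) *v v = N *v v - l *s v" for N :: "complex^'n^'n" and v
    by (simp add: vec_eq_iff matrix_vector_mult_def mat_def left_diff_distrib sum_subtractf
        if_distrib[of "\<lambda>x. x * _"] cong: if_cong)
  have "transpose (M - mat l) = transpose M - mat l"
    by (simp add: vec_eq_iff transpose_def mat_def)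
  then have "transpose (M - mat l) *v w = 0"
    using assms(1) by (simp only: sub) simp
  then have "\<not> invertible (transpose (M - mat l))"
    using assms(2) by (auto simp: invertible_left_inverse matrix_left_invertible_ker)
  then have "\<not> invertible (M - mat l)"
    by (simp add: invertible_det_nz det_transpose)
  then obtain v where "(M - mat l) *v v = 0" "v \<noteq> 0"
    by (auto simp: invertible_left_inverse matrix_left_invertible_ker)
  then show thesis using that by (simp add: sub)
qed

lemma expansive_dual_eigenvalue:
  assumes "expansive A" "w \<noteq> 0" "map_matrix complex_of_real (dual_mat A) *v w = l *s w"
  shows "cmod l > 1"
proof -
  have "map_matrix complex_of_real (dual_mat A) = transpose (map_matrix of_int A)"
    by (simp add: vec_eq_iff transpose_def real_mat_def)
  then obtain v where "v \<noteq> 0" "map_matrix of_int A *v v = l *s v"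
    using eigenvalue_transpose assms(2,3) by metis
  then show ?thesis using assms(1) by (auto simp: expansive_def)
qed

lemma expansive_invertible:
  assumes "expansive A"
  shows "invertible (dual_mat A)"
proof -
  have "x = 0" if "dual_mat A *v x = 0" for x
  proof (rule ccontr)
    assume "x \<noteq> 0"
    have "map_matrix complex_of_real (dual_mat A) *v cvec x = 0 *s cvec x"
      using that by (simp add: cvec_mult cvec_eq_0)
    then show False
      using expansive_dual_eigenvalue[OF assms, of "cvec x" 0] \<open>x \<noteq> 0\<close> by (simp add: cvec_eq_0)
  qed
  then show ?thesis
    by (auto simp: invertible_left_inverse matrix_left_invertible_ker)
qed

lemma matrix_inv_mult:
  assumes "invertible M"
  shows "M ** matrix_inv M = mat 1" "matrix_inv M ** M = mat 1"
  using someI_ex[OF assms[unfolded invertible_def]] by (simp_all add: matrix_inv_def)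

lemma dual_mat_inverse:
  assumes "expansive A"
  shows "dual_mat A *v (matrix_inv (dual_mat A) *v x) = x"
    and "matrix_inv (dual_mat A) *v (dual_mat A *v x) = x"
  by (simp_all only: matrix_vector_mul_assoc matrix_inv_mult[OF expansive_invertible[OF assms]]
      matrix_vector_mul_lid)

text \<open>An eigenvalue \<open>l\<close> of \<open>B\<^sup>-\<^sup>1\<close> is nonzero and \<open>1/l\<close> is an eigenvalue of \<open>B\<close>, so \<open>\<bar>l\<bar> < 1\<close>. This
  is applied to the complexification of \<open>B\<^sup>-\<^sup>1\<close>, which maps complexified real vectors to such
  vectors.\<close>

lemma transpose_inv_pow_tendsto_zero:
  assumes "expansive A"
  shows "(\<lambda>n. transpose_inv_pow A n x) \<longlonglongrightarrow> 0"
proof -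
  let ?N = "matrix_inv (dual_mat A)"
  let ?M = "map_matrix complex_of_real ?N"
  have inv: "map_matrix complex_of_real (dual_mat A) *v (?M *v w) = w" for w
  proof -
    have "map_matrix complex_of_real (dual_mat A) ** ?M
        = map_matrix complex_of_real (dual_mat A ** ?N)"
      by (simp add: vec_eq_iff matrix_matrix_mult_def)
    also have "\<dots> = mat 1"
      using matrix_inv_mult(1)[OF expansive_invertible[OF assms]] by (simp add: vec_eq_iff mat_def)
    finally show ?thesis by (simp add: matrix_vector_mul_assoc)
  qed
  have "(\<lambda>n. (((*v) ?M) ^^ n) (cvec x)) \<longlonglongrightarrow> 0"
  proof (rule matrix_powers_tendsto_zero, rule ccontr)
    fix l w assume l: "cmod l \<ge> 1" "?M *v w = l *s w" "w \<noteq> 0"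
    have "w = l *s (map_matrix complex_of_real (dual_mat A) *v w)"
      using inv[of w] l(2) by (simp add: vector_scalar_commute)
    then have "inverse l *s w = (inverse l * l) *s (map_matrix complex_of_real (dual_mat A) *v w)"
      by (metis vec.scale_scale)
    then have "map_matrix complex_of_real (dual_mat A) *v w = inverse l *s w"
      using l(1) by (cases "l = 0") auto
    then have "cmod (inverse l) > 1"
      using expansive_dual_eigenvalue assms l(3) by blast
    moreover have "cmod (inverse l) \<le> 1"
      using l(1) by (simp add: norm_inverse inverse_le_1_iff)
    ultimately show False by simp
  qed
  moreover have "(((*v) ?M) ^^ n) (cvec x) = cvec (transpose_inv_pow A n x)" for n
    unfolding transpose_inv_pow_def by (induction n) (simp_all add: cvec_mult)
  ultimately have lim: "(\<lambda>n. cvec (transpose_inv_pow A n x)) \<longlonglongrightarrow> 0" by simp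
  show ?thesis
  proof (rule vec_tendstoI)
    fix i
    show "(\<lambda>n. transpose_inv_pow A n x $ i) \<longlonglongrightarrow> (0 :: real^'a) $ i"
      using tendsto_Re[OF tendsto_vec_nth[OF lim, of i]] by (simp add: cvec_def)
  qed
qed

section \<open>Arithmetic on the torus\<close>

lemma e2pi_0: "e2pi 0 = 1"
  by (simp add: e2pi_def vec_eq_iff)

lemma e2pi_minus_mult: "e2pi (- x) * e2pi x = 1" "e2pi x * e2pi (- x) = 1"
  by (simp_all flip: e2pi_add add: e2pi_0)

lemma torus_mult: "z \<in> torus \<Longrightarrow> w \<in> torus \<Longrightarrow> z * w \<in> torus"
  by (simp add: torus_def norm_mult)

lemma torus_nonzero: "z \<in> torus \<Longrightarrow> z $ i \<noteq> 0"
  unfolding torus_def by (metis (mono_tags) mem_Collect_eq norm_zero zero_neq_one)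

lemma torus_mult_left_cancel:
  assumes "w \<in> torus" "w * z = w * z'"
  shows "z = z'"
  using assms torus_nonzero[OF assms(1)] by (simp add: vec_eq_iff)

lemma dist_torus_mult:
  assumes "w \<in> torus"
  shows "dist (w * z) (w * z') = dist z z'"
proof -
  have "dist (w $ i * z $ i) (w $ i * z' $ i) = dist (z $ i) (z' $ i)" for i
    using assms by (simp add: torus_def dist_norm norm_mult flip: right_diff_distrib)
  then show ?thesis by (simp add: dist_vec_def)
qed

lemma torus_mpow_mult:
  assumes "z \<in> torus" "w \<in> torus"
  shows "torus_mpow (z * w) A = torus_mpow z A * torus_mpow w A"
proof -
  obtain x y where "z = e2pi x" "w = e2pi y"
    using assms torus_cases by metis
  then show ?thesis
    by (simp add: torus_mpow_e2pi matrix_vector_right_distrib flip: e2pi_add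
        del: transpose_matrix_vector)
qed

text \<open>The kernel of \<open>e2pi\<close> is the integer lattice, whose nonzero vectors have norm at least 1.\<close>

lemma e2pi_inj_close:
  fixes x y :: "real^'d"
  assumes "e2pi x = e2pi y" "dist x y < 1"
  shows "x = y"
proof -
  obtain m :: "int^'d" where m: "x = y + (\<chi> i. of_int (m $ i))"
    using e2pi_eqD[OF assms(1)] by blast
  have "m $ i = 0" for i
  proof -
    have "\<bar>real_of_int (m $ i)\<bar> < 1"
      using component_le_norm_cart[of "x - y" i] assms(2) by (simp add: m dist_norm)
    then show ?thesis by linarith
  qed
  then show ?thesis by (simp add: m vec_eq_iff)
qed

lemma continuous_on_e2pi [continuous_intros]:
  "continuous_on S f \<Longrightarrow> continuous_on S (\<lambda>x. e2pi (f x))"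
  unfolding e2pi_def cis_conv_exp by (intro continuous_intros)

lemma tendsto_e2pi [tendsto_intros]:
  fixes f :: "'b \<Rightarrow> real^'d"
  assumes "(f \<longlongrightarrow> l) F"
  shows "((\<lambda>x. e2pi (f x)) \<longlongrightarrow> e2pi l) F"
proof -
  have "continuous_on UNIV (e2pi :: real^'d \<Rightarrow> _)"
    by (intro continuous_intros)
  then have "isCont e2pi l" by (simp add: continuous_on_eq_continuous_at)
  then show ?thesis using assms by (rule isCont_tendsto_compose)
qed

text \<open>The section of \<open>e2pi\<close> with values in the cube with sides \<open>(-1/2, 1/2]\<close>. It is continuous at
  the identity of the torus, but not everywhere.\<close>

definition torus_log :: "complex^'d \<Rightarrow> real^'d" where
  "torus_log z = (\<chi> i. Arg (z $ i) / (2 * pi))"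

lemma e2pi_torus_log:
  assumes "z \<in> torus"
  shows "e2pi (torus_log z) = z"
proof -
  have "cis (Arg (z $ i)) = z $ i" for i
    using assms torus_nonzero[OF assms, of i] by (subst cis_Arg) (auto simp: torus_def sgn_eq)
  then show ?thesis
    by (simp add: e2pi_def torus_log_def vec_eq_iff)
qed

lemma torus_log_tendsto_zero:
  assumes "(f \<longlongrightarrow> 1) F"
  shows "((\<lambda>n. torus_log (f n)) \<longlongrightarrow> 0) F"
proof (rule vec_tendstoI)
  fix i
  have "((\<lambda>n. f n $ i) \<longlongrightarrow> 1) F"
    using tendsto_vec_nth[OF assms, of i] by simp
  then have "((\<lambda>n. Arg (f n $ i)) \<longlongrightarrow> Arg 1) F"
    by (rule isCont_tendsto_compose[OF continuous_at_Arg, rotated]) simp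
  then have "((\<lambda>n. Arg (f n $ i) / (2 * pi)) \<longlongrightarrow> 0 / (2 * pi)) F"
    by (intro tendsto_intros) auto
  then show "((\<lambda>n. torus_log (f n) $ i) \<longlongrightarrow> (0 :: real^'b) $ i) F"
    by (simp add: torus_log_def)
qed

text \<open>Distinct points of a finite set keep a positive minimal distance.\<close>

lemma finite_eventually_eq:
  fixes a b :: "nat \<Rightarrow> 'a :: metric_space"
  assumes "finite C" "\<And>n. a n \<in> C" "\<And>n. b n \<in> C" "(\<lambda>n. dist (a n) (b n)) \<longlonglongrightarrow> 0"
  shows "eventually (\<lambda>n. a n = b n) sequentially"
proof -
  \<comment> \<open>The 1 keeps the set nonempty when \<open>C\<close> has at most one point.\<close>
  let ?D = "insert 1 {dist x y | x y. x \<in> C \<and> y \<in> C \<and> x \<noteq> y}"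
  have "{dist x y | x y. x \<in> C \<and> y \<in> C \<and> x \<noteq> y} \<subseteq> (\<lambda>(x, y). dist x y) ` (C \<times> C)"
    by auto
  then have fin: "finite ?D"
    using assms(1) by (meson finite_SigmaI finite_imageI finite_insert finite_subset)
  then have "Min ?D > 0"
    by (subst Min_gr_iff) auto
  then have "eventually (\<lambda>n. dist (a n) (b n) < Min ?D) sequentially"
    using assms(4) by (auto simp: order_tendsto_iff)
  then show ?thesis
  proof eventually_elim
    case (elim n)
    show ?case
    proof (rule ccontr)
      assume "a n \<noteq> b n"
      then have "dist (a n) (b n) \<in> ?D" using assms(2,3) by blast
      then have "Min ?D \<le> dist (a n) (b n)" by (rule Min_le[OF fin])
      then show False using elim by simp
    qed
  qed
qed

section \<open>Leaves of the solenoid\<close>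

lemma transpose_inv_pow_0 [simp]: "transpose_inv_pow A 0 x = x"
  by (simp add: transpose_inv_pow_def)

lemma transpose_inv_pow_Suc:
  "transpose_inv_pow A (Suc n) x = matrix_inv (dual_mat A) *v transpose_inv_pow A n x"
  by (simp add: transpose_inv_pow_def)

lemma linear_transpose_inv_pow: "linear (transpose_inv_pow A n)"
proof (induction n)
  case 0
  have "transpose_inv_pow A 0 = (\<lambda>x. x)" by (simp add: fun_eq_iff)
  then show ?case by (simp add: linear_ident)
next
  case (Suc n)
  have "transpose_inv_pow A (Suc n) = (*v) (matrix_inv (dual_mat A)) \<circ> transpose_inv_pow A n"
    by (simp add: fun_eq_iff transpose_inv_pow_Suc)
  then show ?case
    using Suc linear_compose matrix_vector_mul_linear by metis
qed

text \<open>Each coordinate of a point of the solenoid determines all earlier ones.\<close>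

lemma solenoid_eqI:
  assumes "z \<in> solenoid A" "w \<in> solenoid A" "\<And>n. n \<ge> N \<Longrightarrow> z n = w n"
  shows "z = w"
proof
  fix n
  have "z (N - m) = w (N - m)" for m
  proof (induction m)
    case 0
    then show ?case using assms(3) by simp
  next
    case (Suc m)
    show ?case
    proof (cases "m < N")
      case True
      then have "Suc (N - Suc m) = N - m" by simp
      then show ?thesis using Suc assms(1,2) unfolding solenoid_def by (metis (mono_tags, lifting) mem_Collect_eq)
    next
      case False
      then show ?thesis using Suc by simp
    qed
  qed
  from this[of "N - n"] assms(3)[of n] show "z n = w n"
    by (cases "n \<ge> N") auto
qed

locale solenoid_cycle =
  fixes A :: "int^'d^'d" and p :: nat
    and \<zeta> :: "nat \<Rightarrow> complex^'d" and \<theta> :: "nat \<Rightarrow> real^'d"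
  assumes expansive: "expansive A"
    and cycle: "is_cycle A p \<zeta>"
    and \<zeta>_eq: "j < p \<Longrightarrow> \<zeta> j = e2pi (\<theta> j)"
begin

abbreviation B :: "real^'d^'d" where "B \<equiv> dual_mat A"

abbreviation T :: "nat \<Rightarrow> real^'d \<Rightarrow> real^'d" where "T \<equiv> transpose_inv_pow A"

abbreviation \<iota> :: "(real^'d) \<times> nat \<Rightarrow> nat \<Rightarrow> complex^'d" where "\<iota> \<equiv> hat_i_C A p \<zeta>"

abbreviation \<Omega> :: "(nat \<Rightarrow> complex^'d) set" where "\<Omega> \<equiv> solenoid_C A p \<zeta>"

lemma p_pos: "p > 0"
  using cycle by (simp add: is_cycle_def)

lemma \<zeta>_in_torus: "\<zeta> (n mod p) \<in> torus"
  using cycle p_pos by (simp add: is_cycle_def)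

lemma \<zeta>_power: "torus_mpow (\<zeta> (Suc n mod p)) A = \<zeta> (n mod p)"
  using chi_C_in_solenoid[OF cycle] by (simp add: solenoid_def chi_C_def)

lemma Suc_pred_mod: "(Suc n + pred_mod p j) mod p = (n + j) mod p"
proof -
  have "(Suc n + pred_mod p j) mod p = (Suc n + (j + p - 1)) mod p"
    by (simp only: pred_mod_def mod_add_right_eq)
  also have "Suc n + (j + p - 1) = n + j + p" using p_pos by simp
  finally show ?thesis by simp
qed

lemma B_T_Suc: "B *v T (Suc n) x = T n x"
  by (simp only: transpose_inv_pow_Suc dual_mat_inverse[OF expansive])

lemma T_Suc_B: "T (Suc n) (B *v x) = T n x"
  by (simp only: transpose_inv_pow_def funpow_Suc_right o_apply dual_mat_inverse[OF expansive])

lemma \<iota>_eq: "\<iota> (x, j) n = e2pi (T n x) * \<zeta> ((n + j) mod p)"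
  using p_pos by (simp add: hat_i_C_eq[OF cycle \<zeta>_eq] e2pi_add \<zeta>_eq)

lemma \<iota>_in_solenoid: "\<iota> (x, j) \<in> solenoid A"
proof -
  have "torus_mpow (\<iota> (x, j) (Suc n)) A = \<iota> (x, j) n" for n
    using \<zeta>_power[of "n + j"] \<zeta>_in_torus[of "Suc n + j"]
    by (simp only: \<iota>_eq torus_mpow_mult e2pi_in_torus torus_mpow_e2pi B_T_Suc) simp
  then show ?thesis
    by (simp add: solenoid_def \<iota>_eq torus_mult \<zeta>_in_torus)
qed

lemma leaf_eq: "leaf_C A p \<zeta> j = range (\<lambda>x. \<iota> (x, j))"
  by (simp add: leaf_C_def hat_i_C_def)

lemma \<Omega>_eq: "\<Omega> = \<iota> ` (UNIV \<times> {..<p})"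
  by (auto simp: solenoid_C_def leaf_eq)

lemma sigma_\<iota>:
  shows "sigma_A A (\<iota> (x, j)) = \<iota> (alpha A p (x, j))"
proof
  fix n
  show "sigma_A A (\<iota> (x, j)) n = \<iota> (alpha A p (x, j)) n"
  proof (cases n)
    case 0
    have "torus_mpow (\<zeta> (j mod p)) A = \<zeta> (pred_mod p j mod p)"
      using \<zeta>_power[of "pred_mod p j"] Suc_pred_mod[of 0 j] by simp
    then show ?thesis
      using \<zeta>_in_torus[of j]
      by (simp add: 0 sigma_A_def alpha_def \<iota>_eq torus_mpow_mult torus_mpow_e2pi
          del: transpose_matrix_vector)
  next
    case (Suc m)
    then show ?thesis
      by (simp add: sigma_A_def alpha_def \<iota>_eq T_Suc_B Suc_pred_mod
          del: transpose_matrix_vector add_Suc)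
  qed
qed

lemma sigma_leaf: "sigma_A A ` leaf_C A p \<zeta> j = leaf_C A p \<zeta> (pred_mod p j)"
proof -
  have "range ((*v) B) = UNIV"
    using dual_mat_inverse(1)[OF expansive] by (metis surjI)
  moreover have "sigma_A A ` leaf_C A p \<zeta> j = (\<lambda>x. \<iota> (x, pred_mod p j)) ` range ((*v) B)"
    by (simp add: leaf_eq image_image sigma_\<iota> alpha_def)
  ultimately show ?thesis by (simp add: leaf_eq)
qed

lemma sigma_power_chi: "(sigma_A A ^^ p) (chi_C p \<zeta>) = chi_C p \<zeta>"
proof -
  have "z \<in> solenoid A \<Longrightarrow> (sigma_A A ^^ k) ((sigma_inv A ^^ k) z) = z" for k z
  proof (induction k arbitrary: z)
    case (Suc k)
    have "sigma_inv A z \<in> solenoid A"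
      using Suc.prems by (simp add: sigma_inv_eq) (simp add: solenoid_def)
    moreover have "sigma_A A (sigma_inv A z) = z"
      unfolding sigma_inv_def using Suc.prems bij_betw_sigma
      by (metis bij_betw_imp_surj_on f_inv_into_f)
    ultimately show ?case
      using Suc.IH by (simp add: funpow_swap1[of "sigma_inv A"])
  qed simp
  from this[OF chi_C_in_solenoid[OF cycle], of p] show ?thesis
    by (simp add: sigma_inv_pow_chi_C[OF cycle]) (simp add: chi_C_def)
qed

lemma dist_\<iota>: "dist (\<iota> (x, j) n) (\<zeta> ((n + j) mod p)) = dist (e2pi (T n x)) 1"
  using dist_torus_mult[OF \<zeta>_in_torus, of "n + j" "e2pi (T n x)" 1]
  by (simp add: \<iota>_eq mult.commute)

lemma dist_\<iota>_tendsto_zero: "(\<lambda>n. dist (\<iota> (x, j) n) (\<zeta> ((n + j) mod p))) \<longlonglongrightarrow> 0"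
proof -
  have "(\<lambda>n. dist (e2pi (T n x)) 1) \<longlonglongrightarrow> dist (e2pi 0) (1 :: complex^'d)"
    by (intro tendsto_intros transpose_inv_pow_tendsto_zero expansive)
  then show ?thesis by (simp add: dist_\<iota> e2pi_0)
qed

lemma \<Omega>_imp_asymptotic:
  assumes "z \<in> \<Omega>"
  shows "z \<in> solenoid A" "(\<lambda>n. infdist (z n) (\<zeta> ` {..<p})) \<longlonglongrightarrow> 0"
proof -
  obtain x j where z: "z = \<iota> (x, j)" using assms by (auto simp: \<Omega>_eq)
  then show "z \<in> solenoid A" by (simp add: \<iota>_in_solenoid)
  have "infdist (z n) (\<zeta> ` {..<p}) \<le> dist (z n) (\<zeta> ((n + j) mod p))" for n
    using p_pos by (intro infdist_le) auto
  then show "(\<lambda>n. infdist (z n) (\<zeta> ` {..<p})) \<longlonglongrightarrow> 0"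
    unfolding z
    by (intro Lim_null_comparison[OF always_eventually dist_\<iota>_tendsto_zero[of x j]])
       (simp add: infdist_nonneg)
qed

text \<open>The power map permutes the finite set \<open>C\<close> because the cycle relations make it surjective.\<close>

lemma power_inj_on_cycle: "inj_on (\<lambda>w. torus_mpow w A) (\<zeta> ` {..<p})"
proof (rule eq_card_imp_inj_on)
  have "(\<lambda>w. torus_mpow w A) ` \<zeta> ` {..<p} = \<zeta> ` {..<p}" (is "?f ` ?C = _")
  proof
    show "?f ` ?C \<subseteq> ?C"
    proof clarify
      fix j assume "j < p"
      then have "?f (\<zeta> j) = \<zeta> (pred_mod p j mod p)"
        using \<zeta>_power[of "pred_mod p j"] Suc_pred_mod[of 0 j] by simp
      then show "?f (\<zeta> j) \<in> ?C" using p_pos by simp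
    qed
    show "?C \<subseteq> ?f ` ?C"
    proof clarify
      fix j assume "j < p"
      then have "\<zeta> j = ?f (\<zeta> (Suc j mod p))" using \<zeta>_power[of j] by simp
      moreover have "\<zeta> (Suc j mod p) \<in> ?C" using p_pos by simp
      ultimately show "\<zeta> j \<in> ?f ` ?C" by (rule image_eqI)
    qed
  qed
  then show "card (?f ` ?C) = card ?C" by simp
qed simp

text \<open>The nearest point \<open>\<zeta> (k n)\<close> of the cycle and the small logarithm \<open>\<epsilon> n\<close> of \<open>z n / \<zeta> (k n)\<close> both
  satisfy, up to errors tending to zero, the recursion that defines the solenoid. The errors lie in
  discrete sets, hence vanish from some index \<open>N\<close> on.\<close>

lemma asymptotic_imp_\<Omega>:
  assumes z: "z \<in> solenoid A" and lim: "(\<lambda>n. infdist (z n) (\<zeta> ` {..<p})) \<longlonglongrightarrow> 0"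
  shows "z \<in> \<Omega>"
proof -
  let ?C = "\<zeta> ` {..<p}"
  have z_torus: "z n \<in> torus" and z_power: "torus_mpow (z (Suc n)) A = z n" for n
    using z by (auto simp: solenoid_def)
  have "\<exists>k<p. infdist (z n) ?C = dist (z n) (\<zeta> k)" for n
  proof -
    have "closed ?C" "?C \<noteq> {}"
      using p_pos by (auto intro: finite_imp_closed)
    then obtain c where "c \<in> ?C" "infdist (z n) ?C = dist (z n) c"
      by (rule infdist_attains_inf)
    then show ?thesis by auto
  qed
  then obtain k where k: "\<And>n. k n < p" "\<And>n. infdist (z n) ?C = dist (z n) (\<zeta> (k n))"
    by metis
  have \<zeta>k: "\<zeta> (k n) \<in> torus" for n
    using \<zeta>_in_torus[of "k n"] k(1)[of n] by simp
  define w where "w n = e2pi (- \<theta> (k n)) * z n" for n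
  have w: "w n \<in> torus" "\<zeta> (k n) * w n = z n" for n
  proof -
    show "w n \<in> torus" by (simp add: w_def torus_mult z_torus)
    show "\<zeta> (k n) * w n = z n"
      by (simp add: w_def \<zeta>_eq[OF k(1)] e2pi_minus_mult flip: mult.assoc)
  qed
  define \<epsilon> where "\<epsilon> n = torus_log (w n)" for n
  have e2pi_\<epsilon>: "e2pi (\<epsilon> n) = w n" for n
    by (simp add: \<epsilon>_def e2pi_torus_log w)
  have dist_z: "(\<lambda>n. dist (z n) (\<zeta> (k n))) \<longlonglongrightarrow> 0"
    using lim by (simp add: k)
  moreover have "dist (w n) 1 = dist (z n) (\<zeta> (k n))" for n
    using dist_torus_mult[OF \<zeta>k, of n "w n" 1] by (simp add: w)
  ultimately have "w \<longlonglongrightarrow> 1"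
    by (subst tendsto_dist_iff) simp
  then have \<epsilon>: "\<epsilon> \<longlonglongrightarrow> 0"
    unfolding \<epsilon>_def by (rule torus_log_tendsto_zero)
  then have \<epsilon>_Suc: "(\<lambda>n. \<epsilon> (Suc n)) \<longlonglongrightarrow> 0"
    by (rule LIMSEQ_Suc)
  then have B\<epsilon>: "(\<lambda>n. B *v \<epsilon> (Suc n)) \<longlonglongrightarrow> 0"
    using bounded_linear.tendsto[OF matrix_vector_mul_bounded_linear[of B] \<epsilon>_Suc] by simp
  \<comment> \<open>The point of the cycle that the next nearest point predicts for index \<open>n\<close>.\<close>
  define \<zeta>' where "\<zeta>' n = torus_mpow (\<zeta> (k (Suc n))) A" for n
  have \<zeta>': "\<zeta>' n \<in> ?C" "\<zeta>' n \<in> torus" for n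
  proof -
    have "\<zeta>' n = \<zeta> (pred_mod p (k (Suc n)) mod p)"
      using \<zeta>_power[of "pred_mod p (k (Suc n))"] Suc_pred_mod[of 0 "k (Suc n)"] k(1)[of "Suc n"]
      by (simp add: \<zeta>'_def)
    then show "\<zeta>' n \<in> ?C" "\<zeta>' n \<in> torus" using p_pos \<zeta>_in_torus by auto
  qed
  have z_eq: "z n = \<zeta>' n * e2pi (B *v \<epsilon> (Suc n))" for n
  proof -
    have "z n = torus_mpow (\<zeta> (k (Suc n)) * e2pi (\<epsilon> (Suc n))) A"
      by (simp add: e2pi_\<epsilon> w z_power)
    then show ?thesis
      by (simp only: torus_mpow_mult[OF \<zeta>k e2pi_in_torus] torus_mpow_e2pi \<zeta>'_def)
  qed
  have "(\<lambda>n. dist (e2pi (B *v \<epsilon> (Suc n))) 1) \<longlonglongrightarrow> dist (e2pi 0) (1 :: complex^'d)"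
    by (intro tendsto_intros B\<epsilon>)
  moreover have "dist (z n) (\<zeta>' n) = dist (e2pi (B *v \<epsilon> (Suc n))) 1" for n
    using dist_torus_mult[OF \<zeta>'(2), of n _ 1] by (simp add: z_eq)
  ultimately have "(\<lambda>n. dist (z n) (\<zeta>' n)) \<longlonglongrightarrow> 0"
    by (simp add: e2pi_0)
  from tendsto_add[OF dist_z this]
  have sum: "(\<lambda>n. dist (z n) (\<zeta> (k n)) + dist (z n) (\<zeta>' n)) \<longlonglongrightarrow> 0"
    by simp
  have "(\<lambda>n. dist (\<zeta> (k n)) (\<zeta>' n)) \<longlonglongrightarrow> 0"
    by (rule Lim_null_comparison[OF always_eventually sum]) (simp add: dist_triangle3)
  then have ev1: "eventually (\<lambda>n. \<zeta> (k n) = \<zeta>' n) sequentially"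
    using \<zeta>'(1) k(1) by (intro finite_eventually_eq[of ?C]) auto
  have "(\<lambda>n. dist (\<epsilon> n) (B *v \<epsilon> (Suc n))) \<longlonglongrightarrow> dist (0 :: real^'d) 0"
    by (intro tendsto_intros \<epsilon> B\<epsilon>)
  then have "eventually (\<lambda>n. dist (\<epsilon> n) (B *v \<epsilon> (Suc n)) < 1) sequentially"
    by (auto simp: order_tendsto_iff)
  with ev1 have "eventually (\<lambda>n. \<zeta> (k n) = \<zeta>' n \<and> \<epsilon> n = B *v \<epsilon> (Suc n)) sequentially"
  proof eventually_elim
    case (elim n)
    have "\<zeta> (k n) * e2pi (\<epsilon> n) = \<zeta> (k n) * e2pi (B *v \<epsilon> (Suc n))"
      using z_eq[of n] w(2)[of n] elim(1) by (simp add: e2pi_\<epsilon>)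
    then have "e2pi (\<epsilon> n) = e2pi (B *v \<epsilon> (Suc n))"
      using torus_mult_left_cancel[OF \<zeta>k] by blast
    then show ?case using e2pi_inj_close elim by blast
  qed
  then obtain N where N: "\<And>n. n \<ge> N \<Longrightarrow> \<zeta> (k n) = \<zeta>' n" "\<And>n. n \<ge> N \<Longrightarrow> \<epsilon> n = B *v \<epsilon> (Suc n)"
    by (auto simp: eventually_sequentially)
  \<comment> \<open>The leaf coordinate that makes the logarithms agree from index \<open>N\<close> on.\<close>
  define x where "x = (((*v) B) ^^ N) (\<epsilon> N)"
  have "T m ((((*v) B) ^^ m) y) = y" for m y
  proof (induction m)
    case (Suc m)
    then show ?case by (simp add: T_Suc_B del: transpose_matrix_vector)
  qed simp
  then have "T N x = \<epsilon> N" by (simp add: x_def)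
  then have Tx: "T (N + m) x = \<epsilon> (N + m)" for m
  proof (induction m)
    case (Suc m)
    then show ?case
      using N(2)[of "N + m"] by (simp add: transpose_inv_pow_Suc dual_mat_inverse[OF expansive]
          del: transpose_matrix_vector)
  qed simp
  \<comment> \<open>The residue \<open>k N - N\<close> modulo \<open>p\<close>, written without subtracting below zero.\<close>
  define j where "j = (k N + (p - N mod p)) mod p"
  have "(N + j) mod p = (N mod p + (k N + (p - N mod p))) mod p"
    by (simp add: j_def mod_simps)
  also have "N mod p + (k N + (p - N mod p)) = k N + p"
    using mod_less_divisor[OF p_pos, of N] by linarith
  finally have j: "(N + j) mod p = k N" using k(1)[of N] by simp
  have \<zeta>_k_eq: "\<zeta> (k (N + m)) = \<zeta> ((N + m + j) mod p)" for m
  proof (induction m)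
    case 0
    then show ?case by (simp add: j)
  next
    case (Suc m)
    have "torus_mpow (\<zeta> (k (N + Suc m))) A = torus_mpow (\<zeta> ((N + Suc m + j) mod p)) A"
      using Suc N(1)[of "N + m"] \<zeta>_power[of "N + m + j"] by (simp add: \<zeta>'_def)
    then show ?case
      using power_inj_on_cycle k(1) p_pos by (auto dest: inj_onD)
  qed
  have "z n = \<iota> (x, j) n" if "n \<ge> N" for n
  proof -
    have n: "n = N + (n - N)" using that by simp
    have "z n = \<zeta> (k n) * e2pi (\<epsilon> n)"
      by (simp add: w e2pi_\<epsilon>)
    also have "\<dots> = \<zeta> ((n + j) mod p) * e2pi (T n x)"
      using \<zeta>_k_eq[of "n - N"] Tx[of "n - N"] n by metis
    also have "\<dots> = \<iota> (x, j) n"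
      by (simp only: \<iota>_eq mult.commute)
    finally show ?thesis .
  qed
  then have "z = \<iota> (x, j)"
    by (rule solenoid_eqI[OF z \<iota>_in_solenoid])
  then show ?thesis
    using p_pos by (auto simp: \<Omega>_eq j_def)
qed

lemma \<Omega>_eq_asymptotic: "\<Omega> = {z \<in> solenoid A. (\<lambda>n. infdist (z n) (\<zeta> ` {..<p})) \<longlonglongrightarrow> 0}"
proof (rule set_eqI)
  fix z
  show "z \<in> \<Omega> \<longleftrightarrow> z \<in> {z \<in> solenoid A. (\<lambda>n. infdist (z n) (\<zeta> ` {..<p})) \<longlonglongrightarrow> 0}"
    using \<Omega>_imp_asymptotic[of z] asymptotic_imp_\<Omega>[of z] unfolding mem_Collect_eq by argo
qed

text \<open>Along multiples of \<open>p\<close> the coordinates of \<open>\<iota>(x, j)\<close> converge to \<open>\<zeta>\<^sub>j\<close>, which recovers \<open>j\<close>. Then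
  \<open>B\<^sup>-\<^sup>n x\<close> and \<open>B\<^sup>-\<^sup>n y\<close> differ by integer vectors and both tend to zero, so they agree for some
  \<open>n\<close>.\<close>

lemma inj_on_\<iota>:
  assumes inj: "inj_on \<zeta> {..<p}"
  shows "inj_on \<iota> (UNIV \<times> {..<p})"
proof (rule inj_onI, clarify)
  fix x y :: "real^'d" and j k assume jk: "j < p" "k < p" and eq: "\<iota> (x, j) = \<iota> (y, k)"
  have sub: "strict_mono (\<lambda>m. m * p)"
    using p_pos by (simp add: strict_mono_def)
  have lim: "(\<lambda>m. \<iota> (u, i) (m * p)) \<longlonglongrightarrow> \<zeta> i" if "i < p" for u i
    using LIMSEQ_subseq_LIMSEQ[OF dist_\<iota>_tendsto_zero sub, of u i] that
    by (subst tendsto_dist_iff) (simp add: o_def)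
  have "\<zeta> j = \<zeta> k"
    using LIMSEQ_unique[OF lim[OF jk(1), of x]] lim[OF jk(2), of y] eq by simp
  with inj jk have "j = k" by (auto dest: inj_onD)
  have "e2pi (T n x) = e2pi (T n y)" for n
    using fun_cong[OF eq, of n] torus_mult_left_cancel[OF \<zeta>_in_torus]
    by (simp add: \<open>j = k\<close> \<iota>_eq mult.commute) blast
  moreover have "(\<lambda>n. dist (T n x) (T n y)) \<longlonglongrightarrow> dist (0 :: real^'d) 0"
    by (intro tendsto_intros transpose_inv_pow_tendsto_zero expansive)
  then have "eventually (\<lambda>n. dist (T n x) (T n y) < 1) sequentially"
    by (auto simp: order_tendsto_iff)
  then obtain n where "dist (T n x) (T n y) < 1"
    by (auto simp: eventually_sequentially)
  ultimately have "T n x = T n y" using e2pi_inj_close by blast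
  then have "x = y"
  proof (induction n)
    case (Suc n)
    then show ?case using B_T_Suc by metis
  qed simp
  then show "x = y \<and> j = k" using \<open>j = k\<close> by simp
qed

end

section \<open>Measurability of vectors\<close>

lemma borel_measurable_vec_nth [measurable (raw)]:
  fixes f :: "'a \<Rightarrow> 'b :: euclidean_space ^ 'n"
  assumes "f \<in> borel_measurable M"
  shows "(\<lambda>x. f x $ i) \<in> borel_measurable M"
  using assms borel_measurable_continuous_onI[of "\<lambda>v :: 'b ^ 'n. v $ i"]
  by (rule measurable_compose) (intro continuous_intros)

lemma borel_measurable_vecI:
  fixes f :: "'a \<Rightarrow> 'b :: euclidean_space ^ 'n"
  assumes "\<And>i. (\<lambda>x. f x $ i) \<in> borel_measurable M"
  shows "f \<in> borel_measurable M"
proof -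
  have "(\<lambda>x. f x \<bullet> axis i b) \<in> borel_measurable M" for i and b :: 'b
    using assms[of i] by (simp add: inner_axis)
  then show ?thesis
    by (subst borel_measurable_euclidean_space) (auto simp: Basis_vec_def)
qed

lemma borel_measurable_e2pi [measurable (raw)]:
  assumes "f \<in> borel_measurable M"
  shows "(\<lambda>x. e2pi (f x)) \<in> borel_measurable M"
  using assms borel_measurable_continuous_onI[OF continuous_on_e2pi[OF continuous_on_id]]
  by (rule measurable_compose)

lemma borel_measurable_vec_times [measurable (raw)]:
  fixes f g :: "'a \<Rightarrow> complex ^ 'n"
  assumes "f \<in> borel_measurable M" "g \<in> borel_measurable M"
  shows "(\<lambda>x. f x * g x) \<in> borel_measurable M"
  by (rule borel_measurable_vecI) (use assms in simp)

lemma borel_measurable_Arg [measurable]: "Arg \<in> borel_measurable borel"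
proof -
  let ?S = "- \<real>\<^sub>\<le>\<^sub>0 :: complex set"
  have S: "?S \<in> sets borel" by (intro borel_open open_Compl) simp
  have "(\<lambda>z. if z \<in> ?S then Arg z else if z = 0 then 0 else pi) \<in> borel_measurable borel"
    using S borel_measurable_continuous_on_restrict[OF continuous_on_Arg]
    by (subst measurable_If_restrict_space_iff) (auto intro: measurable_restrict_space1 simp: Compl_eq)
  moreover have "(if z \<in> ?S then Arg z else if z = 0 then 0 else pi) = Arg z" for z
  proof (cases "z = 0")
    case True
    then show ?thesis by (simp add: Arg_zero)
  next
    case False
    then show ?thesis
      using Arg_eq_pi[of z] by (auto simp: complex_nonpos_Reals_iff complex_eq_iff less_le)
  qed
  ultimately show ?thesis by simp
qed

lemma borel_measurable_torus_log [measurable]: "torus_log \<in> borel_measurable borel"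
  by (rule borel_measurable_vecI) (simp add: torus_log_def)

lemma torus_borel [measurable]: "(torus :: (complex^'n) set) \<in> sets borel"
proof -
  have eq: "(torus :: (complex^'n) set) = (\<Inter>i. {z. cmod (z $ i) = 1})"
    by (auto simp: torus_def)
  show ?thesis
    unfolding eq by (intro borel_closed closed_INT ballI closed_Collect_eq continuous_intros)
qed

section \<open>Tiling space by integer translates of the unit cube\<close>

definition int_vec :: "int^'d \<Rightarrow> real^'d" where
  "int_vec m = (\<chi> i. real_of_int (m $ i))"

definition unit_cube :: "(real^'d) set" where
  "unit_cube = {x. \<forall>i. - 1/2 < x $ i \<and> x $ i \<le> 1/2}"

lemma int_vec_uminus: "int_vec (- m) = - int_vec m"
  by (simp add: int_vec_def vec_eq_iff)

lemma int_vec_inj: "int_vec m = int_vec m' \<longleftrightarrow> m = m'"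
  by (simp add: int_vec_def vec_eq_iff)

lemma e2pi_int_vec: "e2pi (x + int_vec m) = e2pi x"
  by (simp only: e2pi_def int_vec_def vec_eq_iff vec_lambda_beta vector_add_component cis_add_int)
     simp

lemma unit_cube_translate: "\<exists>!m. x - int_vec m \<in> unit_cube"
proof
  show "x - int_vec (\<chi> i. \<lceil>x $ i - 1/2\<rceil>) \<in> unit_cube"
  proof -
    have "- 1/2 < x $ i - \<lceil>x $ i - 1/2\<rceil> \<and> x $ i - \<lceil>x $ i - 1/2\<rceil> \<le> 1/2" for i
      by linarith
    then show ?thesis by (simp add: unit_cube_def int_vec_def)
  qed
  fix m assume "x - int_vec m \<in> unit_cube"
  then have "m $ i = \<lceil>x $ i - 1/2\<rceil>" for i
    by (auto simp: unit_cube_def int_vec_def dest!: spec[of _ i]) linarith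
  then show "m = (\<chi> i. \<lceil>x $ i - 1/2\<rceil>)" by (simp add: vec_eq_iff)
qed

lemma unit_cube_borel [measurable]: "unit_cube \<in> sets borel"
proof -
  have "unit_cube = (\<Inter>i. {x :: real^'n. - 1/2 < x $ i} \<inter> {x. x $ i \<le> 1/2})"
    by (auto simp: unit_cube_def)
  also have "\<dots> \<in> sets borel"
    by (intro sets.countable_INT'' sets.Int borel_open borel_closed open_Collect_less
        closed_Collect_le continuous_intros) auto
  finally show ?thesis .
qed

lemma emeasure_unit_cube: "emeasure lborel (unit_cube :: (real^'d) set) = 1"
proof (rule antisym)
  let ?b = "(\<chi> i. 1/2) :: real^'d"
  have half: "?b \<bullet> b = 1/2" if "b \<in> Basis" for b
    using that by (auto simp: Basis_vec_def inner_axis)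
  have prod: "(\<Prod>b\<in>Basis. (?b - - ?b) \<bullet> b) = 1"
  proof (intro prod.neutral ballI)
    fix b :: "real^'d" assume b: "b \<in> Basis"
    then show "(?b - - ?b) \<bullet> b = 1"
      unfolding inner_diff_left inner_minus_left half[OF b] by simp
  qed
  have "emeasure lborel (unit_cube :: (real^'d) set) \<le> emeasure lborel (cbox (- ?b) ?b)"
    by (intro emeasure_mono) (auto simp: unit_cube_def mem_box_cart less_imp_le)
  also have "\<dots> = 1"
    by (subst emeasure_lborel_cbox) (simp_all only: prod half inner_minus_left, simp_all)
  finally show "emeasure lborel (unit_cube :: (real^'d) set) \<le> 1" .
  have "1 = emeasure lborel (box (- ?b) ?b)"
    by (subst emeasure_lborel_box) (simp_all only: prod half inner_minus_left, simp_all)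
  also have "\<dots> \<le> emeasure lborel (unit_cube :: (real^'d) set)"
    by (intro emeasure_mono) (auto simp: unit_cube_def mem_box_cart less_imp_le)
  finally show "1 \<le> emeasure lborel (unit_cube :: (real^'d) set)" .
qed

text \<open>For every \<open>x\<close> exactly one integer translate of the half-open cube contains \<open>x\<close>.\<close>

lemma nn_integral_unit_cube_translates:
  "(\<integral>\<^sup>+m. indicator unit_cube (x - int_vec m) \<partial>count_space UNIV) = 1"
proof -
  obtain m where m: "\<And>k. x - int_vec k \<in> unit_cube \<longleftrightarrow> k = m"
    using unit_cube_translate[of x] by metis
  have "(\<integral>\<^sup>+m. indicator unit_cube (x - int_vec m) \<partial>count_space UNIV)
      = (\<integral>\<^sup>+k. indicator {m} k \<partial>count_space UNIV)"
    by (intro nn_integral_cong) (simp add: m indicator_def)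
  then show ?thesis by simp
qed

lemma nn_integral_lborel_translate:
  assumes [measurable]: "f \<in> borel_measurable borel"
  shows "(\<integral>\<^sup>+x. f (x + c) \<partial>lborel) = (\<integral>\<^sup>+x. f x \<partial>lborel)"
proof -
  have "(\<integral>\<^sup>+x. f x \<partial>lborel) = (\<integral>\<^sup>+x. f x \<partial>distr lborel borel ((+) c))"
    by (simp only: lborel_distr_plus)
  also have "\<dots> = (\<integral>\<^sup>+x. f (x + c) \<partial>lborel)"
    by (subst nn_integral_distr) (simp_all add: add.commute)
  finally show ?thesis by simp
qed

text \<open>Both sides integrate \<open>f\<close> over all translates of the cube; only sums and integrals of nonnegative
  functions are interchanged.\<close>

lemma nn_integral_tiling:
  fixes f :: "real^'d \<Rightarrow> ennreal"
  assumes [measurable]: "f \<in> borel_measurable borel"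
  shows "(\<integral>\<^sup>+u. (\<integral>\<^sup>+m. f (u + int_vec m) \<partial>count_space UNIV) * indicator unit_cube u \<partial>lborel)
    = (\<integral>\<^sup>+x. f x \<partial>lborel)"
proof -
  have "(\<integral>\<^sup>+u. (\<integral>\<^sup>+m. f (u + int_vec m) \<partial>count_space UNIV) * indicator unit_cube u \<partial>lborel)
     = (\<integral>\<^sup>+u. (\<integral>\<^sup>+m. f (u + int_vec m) * indicator unit_cube u \<partial>count_space UNIV) \<partial>lborel)"
    by (simp add: nn_integral_multc)
  also have "\<dots> = (\<integral>\<^sup>+m. (\<integral>\<^sup>+u. f (u + int_vec m) * indicator unit_cube u \<partial>lborel) \<partial>count_space UNIV)"
    by (rule nn_integral_count_space_nn_integral) (auto intro: countableI_type)
  also have "\<dots> = (\<integral>\<^sup>+m. (\<integral>\<^sup>+x. f x * indicator unit_cube (x - int_vec m) \<partial>lborel) \<partial>count_space UNIV)"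
  proof (rule nn_integral_cong)
    fix m :: "int^'d"
    show "(\<integral>\<^sup>+u. f (u + int_vec m) * indicator unit_cube u \<partial>lborel)
        = (\<integral>\<^sup>+x. f x * indicator unit_cube (x - int_vec m) \<partial>lborel)"
      using nn_integral_lborel_translate[of "\<lambda>x. f x * indicator unit_cube (x - int_vec m)" "int_vec m"]
      by simp
  qed
  also have "\<dots> = (\<integral>\<^sup>+x. (\<integral>\<^sup>+m. f x * indicator unit_cube (x - int_vec m) \<partial>count_space UNIV) \<partial>lborel)"
    by (rule nn_integral_count_space_nn_integral[symmetric]) (auto intro: countableI_type)
  also have "\<dots> = (\<integral>\<^sup>+x. f x \<partial>lborel)"
    by (simp add: nn_integral_cmult nn_integral_unit_cube_translates)
  finally show ?thesis .
qed

text \<open>Over any translate of the cube a periodic function has the same integral: the translate, cut along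
  the tiling and moved back, fills the cube exactly once.\<close>

lemma nn_integral_periodic_translate:
  fixes g :: "real^'d \<Rightarrow> ennreal"
  assumes [measurable]: "g \<in> borel_measurable borel" and per: "\<And>x m. g (x + int_vec m) = g x"
  shows "(\<integral>\<^sup>+u. g (u + t) * indicator unit_cube u \<partial>lborel) = (\<integral>\<^sup>+u. g u * indicator unit_cube u \<partial>lborel)"
proof -
  have "(\<integral>\<^sup>+m. indicator unit_cube (u + int_vec m - t) \<partial>count_space UNIV)
      = (\<integral>\<^sup>+m. indicator unit_cube (u - t - int_vec m) \<partial>count_space UNIV)" for u :: "real^'d"
    using nn_integral_bij_count_space[OF bij_uminus, of "\<lambda>m. indicator unit_cube (u - t - int_vec m)"]
    by (simp add: int_vec_uminus algebra_simps)
  then have one: "(\<integral>\<^sup>+m. indicator unit_cube (u + int_vec m - t) \<partial>count_space UNIV) = 1" for u :: "real^'d"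
    by (simp add: nn_integral_unit_cube_translates)
  have "(\<integral>\<^sup>+u. g (u + t) * indicator unit_cube u \<partial>lborel) = (\<integral>\<^sup>+x. g x * indicator unit_cube (x - t) \<partial>lborel)"
    using nn_integral_lborel_translate[of "\<lambda>x. g x * indicator unit_cube (x - t)" t] by simp
  also have "\<dots> = (\<integral>\<^sup>+u. (\<integral>\<^sup>+m. g u * indicator unit_cube (u + int_vec m - t) \<partial>count_space UNIV)
      * indicator unit_cube u \<partial>lborel)"
    by (subst nn_integral_tiling[symmetric]) (simp_all add: per)
  also have "\<dots> = (\<integral>\<^sup>+u. g u * indicator unit_cube u \<partial>lborel)"
    by (simp add: nn_integral_cmult one)
  finally show ?thesis .
qed

section \<open>Haar measure of the torus\<close>

abbreviation torus_borel_space :: "(complex^'d) measure" where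
  "torus_borel_space \<equiv> restrict_space borel torus"

text \<open>A concrete model of Haar measure, to be identified with \<open>haar_torus\<close>.\<close>

definition cube_haar :: "(complex^'d) measure" where
  "cube_haar = distr (restrict_space lborel unit_cube) torus_borel_space e2pi"

lemma e2pi_measurable_torus: "e2pi \<in> restrict_space lborel unit_cube \<rightarrow>\<^sub>M torus_borel_space"
  by (intro measurable_restrict_space2 measurable_restrict_space1) auto

lemma torus_mult_measurable: 
  assumes "w \<in> torus" 
  shows "(*) w \<in> torus_borel_space \<rightarrow>\<^sub>M torus_borel_space"
  using assms
  by (intro measurable_restrict_space2 measurable_restrict_space1) (auto simp: torus_mult space_restrict_space)

lemma sets_cube_haar [measurable_cong, simp]: "sets cube_haar = sets torus_borel_space"
  by (simp add: cube_haar_def)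

lemma space_torus_borel_space: "space torus_borel_space = torus"
  by (simp add: space_restrict_space)

lemma nn_integral_cube_haar:
  assumes "f \<in> borel_measurable torus_borel_space"
  shows "(\<integral>\<^sup>+z. f z \<partial>cube_haar) = (\<integral>\<^sup>+u. f (e2pi u) * indicator unit_cube u \<partial>lborel)"
  using assms
  by (simp add: cube_haar_def nn_integral_distr e2pi_measurable_torus nn_integral_restrict_space)

lemma emeasure_cube_haar:
  assumes "E \<in> sets torus_borel_space"
  shows "emeasure cube_haar E = (\<integral>\<^sup>+u. indicator E (e2pi u) * indicator unit_cube u \<partial>lborel)"
  using nn_integral_cube_haar[of "indicator E"] assms by simp

lemma cube_haar_total: "emeasure cube_haar (torus :: (complex^'d) set) = 1"
  using emeasure_cube_haar[of "torus :: (complex^'d) set"] sets.top[of "torus_borel_space :: (complex^'d) measure"]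
  by (simp add: space_torus_borel_space emeasure_unit_cube)

lemma cube_haar_invariant:
  assumes w: "w \<in> torus"
  shows "distr cube_haar cube_haar ((*) w) = cube_haar"
proof (rule measure_eqI)
  fix E assume "E \<in> sets (distr cube_haar cube_haar ((*) w))"
  then have E: "E \<in> sets torus_borel_space" by simp
  then have [measurable]: "E \<in> sets borel" 
    by (simp add: sets_restrict_space_iff)
  obtain t where t: "w = e2pi t" using w torus_cases by blast
  note [measurable] = torus_mult_measurable[OF w]
  have "emeasure (distr cube_haar cube_haar ((*) w)) E = (\<integral>\<^sup>+z. indicator E z \<partial>distr cube_haar cube_haar ((*) w))"
    using E by simp
  also have "\<dots> = (\<integral>\<^sup>+z. indicator E (w * z) \<partial>cube_haar)"
    using E by (subst nn_integral_distr) auto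
  also have "\<dots> = (\<integral>\<^sup>+u. indicator E (e2pi (u + t)) * indicator unit_cube u \<partial>lborel)"
    by (subst nn_integral_cube_haar
          [OF measurable_compose[OF torus_mult_measurable[OF w] borel_measurable_indicator[OF E]]])
       (simp add: t e2pi_add mult.commute)
  also have "\<dots> = (\<integral>\<^sup>+u. indicator E (e2pi u) * indicator unit_cube u \<partial>lborel)"
    by (rule nn_integral_periodic_translate[of "\<lambda>u. indicator E (e2pi u)"]) (auto simp: e2pi_int_vec)
  also have "\<dots> = emeasure cube_haar E"
    using E by (simp add: emeasure_cube_haar)
  finally show "emeasure (distr cube_haar cube_haar ((*) w)) E = emeasure cube_haar E" .
qed simp

text \<open>Fubini for the convolution of two invariant probability measures: integrating \<open>\<one>\<^sub>E(w z)\<close> first in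
  \<open>z\<close> gives \<open>m\<^sub>1(E)\<close>, and first in \<open>w\<close> gives \<open>m\<^sub>2(E)\<close> because multiplication is commutative.\<close>

lemma haar_unique:
  fixes m1 m2 :: "(complex^'d) measure"
  assumes s1: "sets m1 = sets torus_borel_space" and s2: "sets m2 = sets torus_borel_space"
    and t1: "emeasure m1 torus = 1" and t2: "emeasure m2 torus = 1"
    and i1: "\<And>w. w \<in> torus \<Longrightarrow> distr m1 m1 ((*) w) = m1"
    and i2: "\<And>w. w \<in> torus \<Longrightarrow> distr m2 m2 ((*) w) = m2"
  shows "m1 = m2"
proof (rule measure_eqI)
  show "sets m1 = sets m2" by (simp add: s1 s2)
  have sp: "space m1 = torus" "space m2 = torus"
    using sets_eq_imp_space_eq[OF s1] sets_eq_imp_space_eq[OF s2] by (simp_all add: space_torus_borel_space)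
  interpret m1: finite_measure m1 by (rule finite_measureI) (simp add: sp t1)
  interpret m2: finite_measure m2 by (rule finite_measureI) (simp add: sp t2)
  interpret pair_sigma_finite m1 m2 ..
  fix E assume "E \<in> sets m1"
  then have E: "E \<in> sets torus_borel_space" "E \<in> sets m1" "E \<in> sets m2" by (simp_all add: s1 s2)
  then have Eb [measurable]: "E \<in> sets borel" by (simp add: sets_restrict_space_iff)
  have push: "emeasure m E = (\<integral>\<^sup>+z. indicator E (w * z) \<partial>m)"
    if "w \<in> torus" "distr m m ((*) w) = m" "sets m = sets torus_borel_space" for w m
  proof -
    have w: "(*) w \<in> m \<rightarrow>\<^sub>M m"
      using torus_mult_measurable[OF that(1)] by (simp add: measurable_cong_sets[OF that(3,3)])
    have "E \<in> sets m" using E(1) that(3) by simp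
    then have "emeasure m E = (\<integral>\<^sup>+z. indicator E z \<partial>m)" by simp
    also have "\<dots> = (\<integral>\<^sup>+z. indicator E z \<partial>distr m m ((*) w))"
      by (simp only: that(2))
    also have "\<dots> = (\<integral>\<^sup>+z. indicator E (w * z) \<partial>m)"
      using \<open>E \<in> sets m\<close> by (intro nn_integral_distr[OF w] borel_measurable_indicator) simp
    finally show ?thesis .
  qed
  have [measurable]: "(\<lambda>z. z) \<in> m1 \<rightarrow>\<^sub>M borel" "(\<lambda>z. z) \<in> m2 \<rightarrow>\<^sub>M borel"
    by (simp_all add: measurable_cong_sets[OF s1 refl] measurable_cong_sets[OF s2 refl] measurable_restrict_space1)
  have meas: "(\<lambda>(z, w). indicator E (w * z) :: ennreal) \<in> borel_measurable (m1 \<Otimes>\<^sub>M m2)"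
  proof -
    have "(\<lambda>x. snd x * fst x) \<in> borel_measurable (m1 \<Otimes>\<^sub>M m2)"
      by (intro borel_measurable_vec_times measurable_compose[OF measurable_fst] measurable_compose[OF measurable_snd]) auto
    then show ?thesis
      by (simp add: case_prod_beta')
  qed
  have "emeasure m1 E = (\<integral>\<^sup>+w. emeasure m1 E \<partial>m2)"
    by (simp add: sp t2)
  also have "\<dots> = (\<integral>\<^sup>+w. (\<integral>\<^sup>+z. indicator E (w * z) \<partial>m1) \<partial>m2)"
    by (intro nn_integral_cong push i1 s1) (simp_all add: sp)
  also have "\<dots> = (\<integral>\<^sup>+z. (\<integral>\<^sup>+w. indicator E (z * w) \<partial>m2) \<partial>m1)"
    using Fubini'[OF meas] by (simp add: mult.commute)
  also have "\<dots> = (\<integral>\<^sup>+z. emeasure m2 E \<partial>m1)"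
    by (intro nn_integral_cong push[symmetric] i2 s2) (simp_all add: sp)
  also have "\<dots> = emeasure m2 E"
    by (simp add: sp t1)
  finally show "emeasure m1 E = emeasure m2 E" .
qed

lemma haar_torus_eq: "haar_torus = cube_haar"
  unfolding haar_torus_def
proof (rule the_equality)
  show "sets cube_haar = sets torus_borel_space \<and> emeasure cube_haar torus = 1 \<and>
      (\<forall>w\<in>torus. distr cube_haar cube_haar ((*) w) = (cube_haar :: (complex^'a) measure))"
    using cube_haar_invariant cube_haar_total by auto
next
  fix m :: "(complex^'a) measure"
  assume "sets m = sets torus_borel_space \<and> emeasure m torus = 1 \<and> (\<forall>w\<in>torus. distr m m ((*) w) = m)"
  then show "m = cube_haar"
    by (intro haar_unique[OF _ sets_cube_haar _ cube_haar_total _ cube_haar_invariant]) auto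
qed

section \<open>The parametrization preserves measure\<close>

lemma nn_integral_count_space_Times:
  assumes "countable X" "finite Y"
  shows "(\<integral>\<^sup>+s. f s \<partial>count_space (X \<times> Y)) = (\<Sum>y\<in>Y. \<integral>\<^sup>+x. f (x, y) \<partial>count_space X)"
proof -
  interpret X: sigma_finite_measure "count_space X"
    by (rule sigma_finite_measure_count_space_countable) fact
  interpret Y: sigma_finite_measure "count_space Y"
    by (rule sigma_finite_measure_count_space_finite) fact
  interpret pair_sigma_finite "count_space X" "count_space Y" ..
  have "count_space (X \<times> Y) = count_space X \<Otimes>\<^sub>M count_space Y"
    using assms by (simp add: pair_measure_countable countable_finite)
  then show ?thesis
    using assms nn_integral_snd[of f] 
    by (simp add: nn_integral_count_space_finite pair_measure_countable countable_finite)
qed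

lemma space_leb_count: "space (leb_count p) = UNIV \<times> {..<p}"
  by (simp add: leb_count_def space_pair_measure)

lemma nn_integral_leb_count:
  assumes [measurable]: "f \<in> borel_measurable (leb_count p)"
  shows "(\<integral>\<^sup>+s. f s \<partial>leb_count p) = (\<Sum>j<p. \<integral>\<^sup>+x. f (x, j) \<partial>lborel)"
proof -
  interpret Y: sigma_finite_measure "count_space {..<p}"
    by (rule sigma_finite_measure_count_space_finite) simp
  interpret pair_sigma_finite lborel "count_space {..<p}" ..
  show ?thesis
    using nn_integral_snd[of f] assms
    by (simp add: leb_count_def nn_integral_count_space_finite)
qed

lemma measurable_leb_count:
  assumes "\<And>j. j < p \<Longrightarrow> (\<lambda>x. f (x, j)) \<in> borel \<rightarrow>\<^sub>M N"
  shows "f \<in> leb_count p \<rightarrow>\<^sub>M N"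
proof -
  have "(\<lambda>(j, x). f (x, j)) \<in> count_space {..<p} \<Otimes>\<^sub>M lborel \<rightarrow>\<^sub>M N"
    using assms by (intro measurable_pair_measure_countable1) auto
  then show ?thesis
    unfolding leb_count_def by (subst measurable_pair_swap_iff) simp
qed

lemma measurable_leb_count_section:
  assumes "f \<in> leb_count p \<rightarrow>\<^sub>M N" "j < p"
  shows "(\<lambda>x. f (x, j)) \<in> borel \<rightarrow>\<^sub>M N"
proof -
  have "(\<lambda>x. (x, j)) \<in> lborel \<rightarrow>\<^sub>M leb_count p"
    using assms(2) by (simp add: leb_count_def)
  from measurable_compose[OF this assms(1)] show ?thesis by simp
qed

lemma borel_measurable_nn_integral_count_space:
  fixes f :: "'i :: countable \<Rightarrow> 'a \<Rightarrow> ennreal"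
  assumes "\<And>i. f i \<in> borel_measurable M"
  shows "(\<lambda>x. \<integral>\<^sup>+i. f i x \<partial>count_space UNIV) \<in> borel_measurable M"
proof -
  interpret sigma_finite_measure "count_space (UNIV :: 'i set)"
    by (rule sigma_finite_measure_count_space)
  have "(\<lambda>(i, x). f i x) \<in> borel_measurable (count_space UNIV \<Otimes>\<^sub>M M)"
    using assms by (intro measurable_pair_measure_countable1) auto
  then have "(\<lambda>(x, i). f i x) \<in> borel_measurable (M \<Otimes>\<^sub>M count_space UNIV)"
    by (subst measurable_pair_swap_iff) simp
  then show ?thesis by (rule borel_measurable_nn_integral)
qed

context solenoid_cycle
begin

lemma continuous_on_T [continuous_intros]:
  "continuous_on S f \<Longrightarrow> continuous_on S (\<lambda>x. T n (f x))"
  using linear_continuous_on[OF linear_conv_bounded_linear[THEN iffD1, OF linear_transpose_inv_pow]]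
  by (rule continuous_on_compose2) auto

lemma continuous_on_\<iota>: "continuous_on S (\<lambda>x. \<iota> (x, j))"
proof (rule continuous_on_coordinatewise_then_product)
  fix n
  have "\<iota> (x, j) n = e2pi (T n x + torus_log (\<zeta> ((n + j) mod p)))" for x
    by (simp add: \<iota>_eq e2pi_add e2pi_torus_log \<zeta>_in_torus)
  then show "continuous_on S (\<lambda>x. \<iota> (x, j) n)"
    by (simp only:) (intro continuous_intros)
qed

lemma \<iota>_measurable: "\<iota> \<in> leb_count p \<rightarrow>\<^sub>M restrict_space borel \<Omega>"
proof (rule measurable_restrict_space2)
  show "\<iota> \<in> space (leb_count p) \<rightarrow> \<Omega>"
    by (auto simp: space_leb_count \<Omega>_eq)
  show "\<iota> \<in> borel_measurable (leb_count p)"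
    by (rule measurable_leb_count) (rule borel_measurable_continuous_onI[OF continuous_on_\<iota>])
qed

text \<open>A closed set is a countable union of compact sets, whose continuous images are compact and so
  closed.\<close>

lemma closed_image_\<iota>_borel:
  assumes "closed F"
  shows "(\<lambda>x. \<iota> (x, j)) ` F \<in> sets borel"
proof -
  have "F = (\<Union>n. F \<inter> cball 0 (real n))"
    using real_arch_simple by auto
  then have "(\<lambda>x. \<iota> (x, j)) ` F = (\<Union>n. (\<lambda>x. \<iota> (x, j)) ` (F \<inter> cball 0 (real n)))"
    by (metis image_UN)
  also have "\<dots> \<in> sets borel"
  proof (intro sets.countable_UN subsetI, clarify)
    fix n
    have "compact ((\<lambda>x. \<iota> (x, j)) ` (F \<inter> cball 0 (real n)))"
      by (intro compact_continuous_image continuous_on_\<iota> closed_Int_compact assms compact_cball)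
    then show "(\<lambda>x. \<iota> (x, j)) ` (F \<inter> cball 0 (real n)) \<in> sets borel"
      by (intro borel_closed compact_imp_closed)
  qed
  finally show ?thesis .
qed

end

locale periodic_solenoid_cycle = solenoid_cycle A p \<zeta> \<theta>
  for A :: "int^'d^'d" and p \<zeta> \<theta> +
  assumes inj_\<zeta>: "inj_on \<zeta> {..<p}"
begin

lemma bij_betw_\<iota>: "bij_betw \<iota> (UNIV \<times> {..<p}) \<Omega>"
  using inj_on_\<iota>[OF inj_\<zeta>] by (simp add: bij_betw_def \<Omega>_eq)

abbreviation \<kappa> :: "(nat \<Rightarrow> complex^'d) \<Rightarrow> (real^'d) \<times> nat" where
  "\<kappa> \<equiv> inv_into (UNIV \<times> {..<p}) \<iota>"

lemma \<kappa>_\<iota>: "j < p \<Longrightarrow> \<kappa> (\<iota> (x, j)) = (x, j)"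
  by (rule inv_into_f_f[OF inj_on_\<iota>[OF inj_\<zeta>]]) simp

text \<open>It suffices to look at the two components of \<open>\<kappa>\<close>. Preimages of closed sets under the first, and
  of points under the second, are finite unions of images of closed sets under \<open>\<iota>\<close>.\<close>

lemma \<kappa>_measurable: "\<kappa> \<in> restrict_space borel \<Omega> \<rightarrow>\<^sub>M leb_count p"
  unfolding leb_count_def
proof (rule measurable_pair)
  have sets: "X \<inter> \<Omega> \<in> sets (restrict_space borel \<Omega>)" if "X \<in> sets borel" for X
    using that by (auto simp: sets_restrict_space)
  have \<Omega>_sets: "\<Omega> \<in> sets (restrict_space borel \<Omega>)"
    using sets[OF sets.top] by simp
  show "fst \<circ> \<kappa> \<in> restrict_space borel \<Omega> \<rightarrow>\<^sub>M lborel"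
  proof (subst measurable_cong_sets[OF refl sets_lborel], rule borel_measurableI)
    fix S :: "(real^'d) set" assume "open S"
    let ?X = "\<Union>j<p. (\<lambda>x. \<iota> (x, j)) ` (- S)"
    have "?X \<in> sets borel"
      using \<open>open S\<close> by (intro sets.finite_UN closed_image_\<iota>_borel) auto
    then have "\<Omega> - ?X \<inter> \<Omega> \<in> sets (restrict_space borel \<Omega>)"
      by (intro sets.Diff sets \<Omega>_sets)
    moreover have "(fst \<circ> \<kappa>) -` S \<inter> space (restrict_space borel \<Omega>) = \<Omega> - ?X \<inter> \<Omega>"
    proof -
      have iff: "fst (\<kappa> z) \<in> S \<longleftrightarrow> z \<notin> ?X" if "z \<in> \<Omega>" for z
      proof -
        obtain x j where z: "z = \<iota> (x, j)" "j < p" using \<open>z \<in> \<Omega>\<close> by (auto simp: \<Omega>_eq)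
        have "z \<in> ?X \<longleftrightarrow> x \<notin> S"
        proof
          assume "z \<in> ?X"
          then obtain y k where "k < p" "y \<notin> S" "z = \<iota> (y, k)" by auto
          then have "(x, j) = (y, k)" using \<kappa>_\<iota> z by metis
          then show "x \<notin> S" using \<open>y \<notin> S\<close> by simp
        qed (use z in blast)
        then show ?thesis using z by (simp add: \<kappa>_\<iota>)
      qed
      have "(fst \<circ> \<kappa>) -` S \<inter> space (restrict_space borel \<Omega>) = {z \<in> \<Omega>. fst (\<kappa> z) \<in> S}"
        by (auto simp: space_restrict_space)
      also have "\<dots> = {z \<in> \<Omega>. z \<notin> ?X}"
        by (intro Collect_cong conj_cong refl iff)
      finally show ?thesis by blast
    qed
    ultimately show "(fst \<circ> \<kappa>) -` S \<inter> space (restrict_space borel \<Omega>)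
        \<in> sets (restrict_space borel \<Omega>)" by simp
  qed
  show "snd \<circ> \<kappa> \<in> restrict_space borel \<Omega> \<rightarrow>\<^sub>M count_space {..<p}"
  proof (subst measurable_count_space_eq2, simp, intro conjI ballI)
    show "snd \<circ> \<kappa> \<in> space (restrict_space borel \<Omega>) \<rightarrow> {..<p}"
      by (auto simp: space_restrict_space \<Omega>_eq \<kappa>_\<iota>)
    fix j assume "j \<in> {..<p}"
    then have "(snd \<circ> \<kappa>) -` {j} \<inter> space (restrict_space borel \<Omega>) = range (\<lambda>x. \<iota> (x, j)) \<inter> \<Omega>"
      by (auto simp: space_restrict_space \<Omega>_eq \<kappa>_\<iota>) (metis \<kappa>_\<iota> snd_conv)
    then show "(snd \<circ> \<kappa>) -` {j} \<inter> space (restrict_space borel \<Omega>) \<in> sets (restrict_space borel \<Omega>)"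
      using sets[OF closed_image_\<iota>_borel[OF closed_UNIV]] by simp
  qed
qed

lemma fibre_eq:
  assumes "j < p"
  shows "\<iota> (x, j) 0 = e2pi u \<longleftrightarrow> (\<exists>m. x = u + int_vec m - \<theta> j)"
proof -
  have "\<iota> (x, j) 0 = e2pi (x + \<theta> j)"
    using assms by (simp add: \<iota>_eq e2pi_add \<zeta>_eq)
  also have "\<dots> = e2pi u \<longleftrightarrow> (\<exists>m. x + \<theta> j = u + int_vec m)"
    by (metis e2pi_eqD e2pi_int_vec int_vec_def)
  also have "\<dots> \<longleftrightarrow> (\<exists>m. x = u + int_vec m - \<theta> j)"
    by (simp add: algebra_simps)
  finally show ?thesis .
qed

lemma bij_betw_fibre:
  "bij_betw (\<lambda>(m, j). \<iota> (u + int_vec m - \<theta> j, j)) (UNIV \<times> {..<p}) {s \<in> \<Omega>. s 0 = e2pi u}"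
  unfolding bij_betw_def
proof
  show "inj_on (\<lambda>(m, j). \<iota> (u + int_vec m - \<theta> j, j)) (UNIV \<times> {..<p})"
  proof (rule inj_onI, clarify)
    fix m m' j j'
    assume j: "j < p" "j' < p" and "\<iota> (u + int_vec m - \<theta> j, j) = \<iota> (u + int_vec m' - \<theta> j', j')"
    then have "\<kappa> (\<iota> (u + int_vec m - \<theta> j, j)) = \<kappa> (\<iota> (u + int_vec m' - \<theta> j', j'))" by simp
    then show "m = m' \<and> j = j'" using j by (auto simp: \<kappa>_\<iota> int_vec_inj)
  qed
  show "(\<lambda>(m, j). \<iota> (u + int_vec m - \<theta> j, j)) ` (UNIV \<times> {..<p}) = {s \<in> \<Omega>. s 0 = e2pi u}"
  proof (intro equalityI subsetI)
    fix s assume "s \<in> {s \<in> \<Omega>. s 0 = e2pi u}"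
    then obtain x j where s: "s = \<iota> (x, j)" "j < p" "\<iota> (x, j) 0 = e2pi u"
      by (auto simp: \<Omega>_eq)
    then obtain m where "x = u + int_vec m - \<theta> j" using fibre_eq by blast
    with s show "s \<in> (\<lambda>(m, j). \<iota> (u + int_vec m - \<theta> j, j)) ` (UNIV \<times> {..<p})"
      by (intro image_eqI[of _ _ "(m, j)"]) auto
  next
    fix s assume "s \<in> (\<lambda>(m, j). \<iota> (u + int_vec m - \<theta> j, j)) ` (UNIV \<times> {..<p})"
    then obtain m j where s: "s = \<iota> (u + int_vec m - \<theta> j, j)" "j < p" by auto
    then have "s 0 = e2pi u" using fibre_eq by blast
    with s show "s \<in> {s \<in> \<Omega>. s 0 = e2pi u}" by (auto simp: \<Omega>_eq)
  qed
qed

lemma nn_integral_fibre: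
  "(\<integral>\<^sup>+s. f s \<partial>count_space {s \<in> \<Omega>. s 0 = e2pi u})
    = (\<Sum>j<p. \<integral>\<^sup>+m. f (\<iota> (u + int_vec m - \<theta> j, j)) \<partial>count_space UNIV)"
proof -
  have "(\<integral>\<^sup>+s. f s \<partial>count_space {s \<in> \<Omega>. s 0 = e2pi u})
      = (\<integral>\<^sup>+s. f (case s of (m, j) \<Rightarrow> \<iota> (u + int_vec m - \<theta> j, j)) \<partial>count_space (UNIV \<times> {..<p}))"
    by (rule nn_integral_bij_count_space[OF bij_betw_fibre, symmetric])
  also have "\<dots> = (\<Sum>j<p. \<integral>\<^sup>+m. f (\<iota> (u + int_vec m - \<theta> j, j)) \<partial>count_space UNIV)"
    by (subst nn_integral_count_space_Times) (auto intro: countableI_type)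
  finally show ?thesis .
qed

text \<open>For \<open>z = e2pi u\<close> the sum over the fibre of \<open>z\<close> is a sum over integer translates of \<open>u - \<theta>\<^sub>j\<close>, so
  that integration over the cube unfolds it to an integral over the whole space.\<close>

lemma mu_tilde_formula:
  assumes E: "E \<in> sets (restrict_space borel \<Omega>)"
  shows "(\<integral>\<^sup>+z. (\<integral>\<^sup>+s. indicator E s \<partial>count_space {s \<in> \<Omega>. s 0 = z}) \<partial>haar_torus)
    = emeasure (distr (leb_count p) (restrict_space borel \<Omega>) \<iota>) E"
proof -
  define h :: "real^'d \<Rightarrow> nat \<Rightarrow> ennreal" where "h x j = indicator E (\<iota> (x, j))" for x j
  have ind: "(\<lambda>s. indicator E (\<iota> s) :: ennreal) \<in> borel_measurable (leb_count p)"
    by (rule measurable_compose[OF \<iota>_measurable borel_measurable_indicator[OF E]])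
  have h: "(\<lambda>x. h x j) \<in> borel_measurable borel" if "j < p" for j
    unfolding h_def by (rule measurable_leb_count_section[OF ind that])
  define G where "G u = (\<Sum>j<p. \<integral>\<^sup>+m. h (u + int_vec m - \<theta> j) j \<partial>count_space UNIV)" for u
  have inner: "(\<lambda>u. \<integral>\<^sup>+m. h (u + int_vec m - \<theta> j) j \<partial>count_space UNIV) \<in> borel_measurable borel"
    if "j < p" for j
  proof (rule borel_measurable_nn_integral_count_space)
    fix m :: "int^'d"
    show "(\<lambda>u. h (u + int_vec m - \<theta> j) j) \<in> borel_measurable borel"
      by (rule measurable_compose[OF _ h[OF that]]) simp
  qed
  then have G [measurable]: "G \<in> borel_measurable borel"
    unfolding G_def by (intro borel_measurable_sum) simp
  have fibre: "(\<integral>\<^sup>+s. indicator E s \<partial>count_space {s \<in> \<Omega>. s 0 = e2pi u}) = G u" for u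
    by (simp add: nn_integral_fibre G_def h_def)
  \<comment> \<open>The fibre count \<open>G\<close> is measurable in \<open>u\<close>; the Borel section \<open>torus_log\<close> turns it into a
    measurable function of \<open>z\<close>.\<close>
  have Glog: "(\<lambda>z. G (torus_log z)) \<in> borel_measurable torus_borel_space"
    by (intro measurable_restrict_space1) simp
  have "(\<integral>\<^sup>+z. (\<integral>\<^sup>+s. indicator E s \<partial>count_space {s \<in> \<Omega>. s 0 = z}) \<partial>haar_torus)
      = (\<integral>\<^sup>+z. G (torus_log z) \<partial>cube_haar)"
    unfolding haar_torus_eq
    by (intro nn_integral_cong) (simp add: cube_haar_def space_torus_borel_space e2pi_torus_log flip: fibre)
  also have "\<dots> = (\<integral>\<^sup>+u. G (torus_log (e2pi u)) * indicator unit_cube u \<partial>lborel)"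
    by (rule nn_integral_cube_haar[OF Glog])
  also have "\<dots> = (\<integral>\<^sup>+u. G u * indicator unit_cube u \<partial>lborel)"
    by (simp add: e2pi_torus_log flip: fibre)
  also have "\<dots> = (\<Sum>j<p. \<integral>\<^sup>+u. (\<integral>\<^sup>+m. h (u + int_vec m - \<theta> j) j \<partial>count_space UNIV) * indicator unit_cube u \<partial>lborel)"
    unfolding G_def sum_distrib_right using inner by (intro nn_integral_sum borel_measurable_times_ennreal) auto
  also have "\<dots> = (\<Sum>j<p. \<integral>\<^sup>+x. h x j \<partial>lborel)"
  proof (rule sum.cong[OF refl])
    fix j assume "j \<in> {..<p}"
    then have [measurable]: "(\<lambda>x. h x j) \<in> borel_measurable borel" by (simp add: h)
    show "(\<integral>\<^sup>+u. (\<integral>\<^sup>+m. h (u + int_vec m - \<theta> j) j \<partial>count_space UNIV) * indicator unit_cube u \<partial>lborel)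
        = (\<integral>\<^sup>+x. h x j \<partial>lborel)"
      using nn_integral_tiling[of "\<lambda>x. h (x - \<theta> j) j"]
        nn_integral_lborel_translate[of "\<lambda>x. h x j" "- \<theta> j"] by simp
  qed
  also have "\<dots> = (\<integral>\<^sup>+s. indicator E (\<iota> s) \<partial>leb_count p)"
    by (simp add: nn_integral_leb_count[OF ind] h_def)
  also have "\<dots> = (\<integral>\<^sup>+s. indicator E s \<partial>distr (leb_count p) (restrict_space borel \<Omega>) \<iota>)"
    by (intro nn_integral_distr[OF \<iota>_measurable, symmetric] borel_measurable_indicator)
       (simp only: sets_distr E)
  finally show ?thesis using E by simp
qed

text \<open>The formula defining the measure agrees with a genuine measure on the \<open>\<sigma>\<close>-algebra, so its
  countable additivity comes for free.\<close>

lemma mu_tilde_eq: "mu_tilde A p \<zeta> = distr (leb_count p) (restrict_space borel \<Omega>) \<iota>"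
proof -
  let ?N = "distr (leb_count p) (restrict_space borel \<Omega>) \<iota>"
  have "mu_tilde A p \<zeta> = measure_of \<Omega> (sets (restrict_space borel \<Omega>)) (emeasure ?N)"
    unfolding mu_tilde_def
  proof (rule measure_of_eq)
    have sp: "space (restrict_space borel \<Omega>) = \<Omega>" by (simp add: space_restrict_space)
    then show "sets (restrict_space borel \<Omega>) \<subseteq> Pow \<Omega>"
      using sets.space_closed[of "restrict_space borel \<Omega>"] by simp
    fix E assume "E \<in> sigma_sets \<Omega> (sets (restrict_space borel \<Omega>))"
    then have "E \<in> sets (restrict_space borel \<Omega>)"
      using sets.sigma_sets_eq[of "restrict_space borel \<Omega>"] by (simp only: sp)
    then show "(\<integral>\<^sup>+z. (\<integral>\<^sup>+s. indicator E s \<partial>count_space {s \<in> \<Omega>. s 0 = z}) \<partial>haar_torus) = emeasure ?N E"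
      by (rule mu_tilde_formula)
  qed
  also have "\<dots> = ?N"
    using measure_of_of_measure[of ?N] by (simp add: space_restrict_space)
  finally show ?thesis .
qed

lemma \<iota>_measure_preserving: "bij_measure_preserving (leb_count p) (mu_tilde A p \<zeta>) \<iota>"
  unfolding bij_measure_preserving_def mu_tilde_eq
  using bij_betw_\<iota> \<iota>_measurable \<kappa>_measurable
  by (auto simp: space_restrict_space space_leb_count emeasure_distr)

end

section \<open>Square-integrable classes and measure isomorphisms\<close>

text \<open>An operator on functions that induces an operator on classes. Relating \<open>h\<close> to itself shows that
  it also preserves square-integrability.\<close>

definition L2_map :: "'a measure \<Rightarrow> 'b measure \<Rightarrow> (('a \<Rightarrow> complex) \<Rightarrow> 'b \<Rightarrow> complex) \<Rightarrow> bool" where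
  "L2_map M N T \<longleftrightarrow> (\<forall>h k. (h, k) \<in> L2_rel M \<longrightarrow> (T h, T k) \<in> L2_rel N)"

lemma L2_rel_refl: "h \<in> L2_fun M \<Longrightarrow> (h, h) \<in> L2_rel M"
  by (simp add: L2_rel_def)

lemma L2_rel_sym: "(h, k) \<in> L2_rel M \<Longrightarrow> (k, h) \<in> L2_rel M"
  unfolding L2_rel_def by (auto intro: AE_symmetric)

lemma L2_relD: 
  assumes "(h, k) \<in> L2_rel M" 
  shows "h \<in> L2_fun M" "k \<in> L2_fun M" "AE x in M. h x = k x"
  using assms by (auto simp: L2_rel_def)

lemma L2_rel_trans:
  assumes "(h, k) \<in> L2_rel M" "(k, l) \<in> L2_rel M"
  shows "(h, l) \<in> L2_rel M"
proof -
  have "AE x in M. h x = l x"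
    using assms(1)[THEN L2_relD(3)] assms(2)[THEN L2_relD(3)] by eventually_elim simp
  then show ?thesis
    using assms[THEN L2_relD(1)] assms[THEN L2_relD(2)] by (simp add: L2_rel_def)
qed

lemma equiv_L2_rel: "equiv (L2_fun M) (L2_rel M)"
proof (rule equivI)
  show "L2_rel M \<subseteq> L2_fun M \<times> L2_fun M" by (auto simp: L2_rel_def)
  show "refl_on (L2_fun M) (L2_rel M)" by (auto simp: refl_on_def L2_rel_def)
  show "sym (L2_rel M)" by (rule symI) (rule L2_rel_sym)
  show "trans (L2_rel M)" by (rule transI) (rule L2_rel_trans)
qed

lemma L2_class_eq_iff:
  assumes "h \<in> L2_fun M" "k \<in> L2_fun M"
  shows "L2_rel M `` {h} = L2_rel M `` {k} \<longleftrightarrow> (h, k) \<in> L2_rel M"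
  using eq_equiv_class_iff[OF equiv_L2_rel assms] .

lemma L2_cases:
  assumes "F \<in> L2 M"
  obtains h where "h \<in> L2_fun M" "F = L2_rel M `` {h}"
  using assms unfolding L2_def by (auto elim: quotientE)

lemma L2_class_in: "h \<in> L2_fun M \<Longrightarrow> L2_rel M `` {h} \<in> L2 M"
  unfolding L2_def by (rule quotientI)

lemma L2_image_class:
  assumes "X \<noteq> {}" "\<And>h. h \<in> X \<Longrightarrow> (k, h) \<in> L2_rel M"
  shows "L2_rel M `` X = L2_rel M `` {k}"
proof (intro equalityI subsetI)
  fix l assume "l \<in> L2_rel M `` X"
  then obtain h where "h \<in> X" "(h, l) \<in> L2_rel M" by blast
  then show "l \<in> L2_rel M `` {k}" using L2_rel_trans[OF assms(2)] by simp
next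
  fix l assume "l \<in> L2_rel M `` {k}"
  moreover obtain h where "h \<in> X" using assms(1) by blast
  ultimately show "l \<in> L2_rel M `` X" using L2_rel_trans[OF L2_rel_sym[OF assms(2)]] by blast
qed

lemma L2_fun_iff:
  "h \<in> L2_fun M \<longleftrightarrow> h \<in> borel_measurable M \<and> (\<integral>\<^sup>+x. ennreal ((cmod (h x))\<^sup>2) \<partial>M) < \<infinity>"
  by (auto simp: L2_fun_def integrable_iff_bounded)

lemma L2_fun_cong:
  assumes "h \<in> L2_fun M" "\<And>x. x \<in> space M \<Longrightarrow> k x = h x"
  shows "k \<in> L2_fun M"
proof -
  have "k \<in> borel_measurable M"
    using assms by (subst measurable_cong[of _ _ h]) (auto simp: L2_fun_iff)
  moreover have "(\<integral>\<^sup>+x. ennreal ((cmod (k x))\<^sup>2) \<partial>M) = (\<integral>\<^sup>+x. ennreal ((cmod (h x))\<^sup>2) \<partial>M)"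
    by (intro nn_integral_cong) (simp add: assms)
  ultimately show ?thesis using assms(1) by (simp add: L2_fun_iff)
qed

lemma L2_rel_cong:
  assumes "(h, k) \<in> L2_rel M" "\<And>x. x \<in> space M \<Longrightarrow> h' x = h x" "\<And>x. x \<in> space M \<Longrightarrow> k' x = k x"
  shows "(h', k') \<in> L2_rel M"
proof -
  have "AE x in M. h' x = k' x"
    using L2_relD(3)[OF assms(1)] AE_space by eventually_elim (simp add: assms)
  then show ?thesis
    using L2_fun_cong[OF L2_relD(1)[OF assms(1)] assms(2)] L2_fun_cong[OF L2_relD(2)[OF assms(1)] assms(3)]
    by (simp add: L2_rel_def)
qed

lemma L2_fun_add:
  assumes "h \<in> L2_fun M" "k \<in> L2_fun M"
  shows "(\<lambda>x. h x + k x) \<in> L2_fun M"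
proof -
  have [measurable]: "h \<in> borel_measurable M" "k \<in> borel_measurable M"
    and int: "integrable M (\<lambda>x. (cmod (h x))\<^sup>2)" "integrable M (\<lambda>x. (cmod (k x))\<^sup>2)"
    using assms by (auto simp: L2_fun_def)
  have "integrable M (\<lambda>x. (cmod (h x + k x))\<^sup>2)"
  proof (rule Bochner_Integration.integrable_bound)
    show "integrable M (\<lambda>x. 2 * (cmod (h x))\<^sup>2 + 2 * (cmod (k x))\<^sup>2)"
      using int by simp
    have "(cmod (h x + k x))\<^sup>2 \<le> 2 * (cmod (h x))\<^sup>2 + 2 * (cmod (k x))\<^sup>2" for x
    proof -
      have "(cmod (h x + k x))\<^sup>2 \<le> (cmod (h x) + cmod (k x))\<^sup>2"
        by (intro power_mono norm_triangle_ineq) simp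
      also have "\<dots> \<le> 2 * (cmod (h x))\<^sup>2 + 2 * (cmod (k x))\<^sup>2"
        using sum_squares_bound[of "cmod (h x)" "cmod (k x)"] by (simp add: power2_sum)
      finally show ?thesis .
    qed
    then show "AE x in M. norm ((cmod (h x + k x))\<^sup>2) \<le> norm (2 * (cmod (h x))\<^sup>2 + 2 * (cmod (k x))\<^sup>2)"
      by simp
  qed simp
  then show ?thesis by (simp add: L2_fun_def)
qed

lemma L2_fun_scale: "h \<in> L2_fun M \<Longrightarrow> (\<lambda>x. c * h x) \<in> L2_fun M"
  by (auto simp: L2_fun_def norm_mult power_mult_distrib)

lemma L2_add_class:
  assumes "h \<in> L2_fun M" "k \<in> L2_fun M"
  shows "L2_add M (L2_rel M `` {h}) (L2_rel M `` {k}) = L2_rel M `` {\<lambda>x. h x + k x}"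
  unfolding L2_add_def
proof (rule L2_image_class)
  show "{\<lambda>x. f x + g x |f g. f \<in> L2_rel M `` {h} \<and> g \<in> L2_rel M `` {k}} \<noteq> {}"
    using assms L2_rel_refl by blast
  fix l assume "l \<in> {\<lambda>x. f x + g x |f g. f \<in> L2_rel M `` {h} \<and> g \<in> L2_rel M `` {k}}"
  then obtain f g where l: "l = (\<lambda>x. f x + g x)" and fg: "(h, f) \<in> L2_rel M" "(k, g) \<in> L2_rel M"
    by blast
  have "AE x in M. h x + k x = f x + g x"
    using L2_relD(3)[OF fg(1)] L2_relD(3)[OF fg(2)] by eventually_elim simp
  then show "(\<lambda>x. h x + k x, l) \<in> L2_rel M"
    using L2_fun_add[OF assms] L2_fun_add[OF fg[THEN L2_relD(2)]] by (simp add: L2_rel_def l)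
qed

lemma L2_scale_class:
  assumes "h \<in> L2_fun M"
  shows "L2_scale M c (L2_rel M `` {h}) = L2_rel M `` {\<lambda>x. c * h x}"
  unfolding L2_scale_def
proof (rule L2_image_class)
  show "{\<lambda>x. c * f x |f. f \<in> L2_rel M `` {h}} \<noteq> {}"
    using assms L2_rel_refl by blast
  fix l assume "l \<in> {\<lambda>x. c * f x |f. f \<in> L2_rel M `` {h}}"
  then obtain f where l: "l = (\<lambda>x. c * f x)" and f: "(h, f) \<in> L2_rel M"
    by blast
  have "AE x in M. c * h x = c * f x"
    using L2_relD(3)[OF f] by eventually_elim simp
  then show "(\<lambda>x. c * h x, l) \<in> L2_rel M"
    using L2_fun_scale[OF assms] L2_fun_scale[OF L2_relD(2)[OF f]] by (simp add: L2_rel_def l)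
qed

lemma L2_norm_class:
  assumes "h \<in> L2_fun M"
  shows "L2_norm M (L2_rel M `` {h}) = sqrt (\<integral>x. (cmod (h x))\<^sup>2 \<partial>M)"
proof -
  have "(\<integral>x. (cmod (f x))\<^sup>2 \<partial>M) = (\<integral>x. (cmod (h x))\<^sup>2 \<partial>M)" if f: "(h, f) \<in> L2_rel M" for f
  proof (rule integral_cong_AE)
    show "AE x in M. (cmod (f x))\<^sup>2 = (cmod (h x))\<^sup>2"
      using L2_relD(3)[OF f] by eventually_elim simp
  qed (use L2_relD(1,2)[OF f] in \<open>auto simp: L2_fun_def\<close>)
  then have "(\<lambda>f. sqrt (\<integral>x. (cmod (f x))\<^sup>2 \<partial>M)) ` (L2_rel M `` {h})
      = (\<lambda>f. sqrt (\<integral>x. (cmod (h x))\<^sup>2 \<partial>M)) ` (L2_rel M `` {h})"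
    by (intro image_cong refl) simp
  also have "\<dots> = {sqrt (\<integral>x. (cmod (h x))\<^sup>2 \<partial>M)}"
    by (rule image_constant[of h]) (simp add: L2_rel_refl[OF assms])
  finally show ?thesis by (simp add: L2_norm_def)
qed

lemma L2_op_class:
  assumes "L2_map M N T" "h \<in> L2_fun M"
  shows "L2_op N T (L2_rel M `` {h}) = L2_rel N `` {T h}"
  unfolding L2_op_def
  using assms(1) L2_rel_refl[OF assms(2)] by (intro L2_image_class) (auto simp: L2_map_def)

lemma L2_map_fun: "L2_map M N T \<Longrightarrow> h \<in> L2_fun M \<Longrightarrow> T h \<in> L2_fun N"
  unfolding L2_map_def using L2_rel_refl L2_relD(1) by metis

lemma L2_map_unimodular:
  assumes [measurable]: "m \<in> borel_measurable M" and m: "\<And>x. x \<in> space M \<Longrightarrow> cmod (m x) = 1"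
  shows "L2_map M M (\<lambda>h x. m x * h x)"
proof -
  have pres: "(\<lambda>x. m x * h x) \<in> L2_fun M" if "h \<in> L2_fun M" for h
  proof -
    have [measurable]: "h \<in> borel_measurable M" using that by (simp add: L2_fun_def)
    have "(\<integral>\<^sup>+x. ennreal ((cmod (m x * h x))\<^sup>2) \<partial>M) = (\<integral>\<^sup>+x. ennreal ((cmod (h x))\<^sup>2) \<partial>M)"
      by (intro nn_integral_cong) (simp add: m norm_mult)
    then show ?thesis using that by (simp add: L2_fun_iff)
  qed
  show ?thesis
    unfolding L2_map_def
  proof (intro allI impI)
    fix h k assume hk: "(h, k) \<in> L2_rel M"
    have "AE x in M. m x * h x = m x * k x"
      using L2_relD(3)[OF hk] by eventually_elim simp
    then show "(\<lambda>x. m x * h x, \<lambda>x. m x * k x) \<in> L2_rel M"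
      using pres L2_relD(1,2)[OF hk] by (simp add: L2_rel_def)
  qed
qed

text \<open>The scaling identity gives preservation of the norm. Applied to the indicator of the set where two
  functions differ, it shows that \<open>\<alpha>\<close> pulls null sets back to null sets, so the operator is well
  defined on classes.\<close>

lemma L2_map_dilation:
  assumes \<alpha>: "\<alpha> \<in> M \<rightarrow>\<^sub>M M" and D: "D \<ge> 0"
    and scale: "\<And>g. g \<in> borel_measurable M \<Longrightarrow> ennreal D * (\<integral>\<^sup>+x. g (\<alpha> x) \<partial>M) = (\<integral>\<^sup>+x. g x \<partial>M)"
  shows "L2_map M M (\<lambda>h x. complex_of_real (sqrt D) * h (\<alpha> x))"
proof -
  have pres: "(\<lambda>x. complex_of_real (sqrt D) * h (\<alpha> x)) \<in> L2_fun M" if "h \<in> L2_fun M" for h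
  proof -
    have h [measurable]: "h \<in> borel_measurable M" using that by (simp add: L2_fun_def)
    have h\<alpha> [measurable]: "(\<lambda>x. h (\<alpha> x)) \<in> borel_measurable M"
      by (rule measurable_compose[OF \<alpha> h])
    have "(\<integral>\<^sup>+x. ennreal ((cmod (complex_of_real (sqrt D) * h (\<alpha> x)))\<^sup>2) \<partial>M)
        = (\<integral>\<^sup>+x. ennreal D * ennreal ((cmod (h (\<alpha> x)))\<^sup>2) \<partial>M)"
      using D by (intro nn_integral_cong) (simp add: norm_mult power_mult_distrib ennreal_mult)
    also have "\<dots> = ennreal D * (\<integral>\<^sup>+x. ennreal ((cmod (h (\<alpha> x)))\<^sup>2) \<partial>M)"
      by (rule nn_integral_cmult) simp
    also have "\<dots> = (\<integral>\<^sup>+x. ennreal ((cmod (h x))\<^sup>2) \<partial>M)"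
      by (rule scale) simp
    finally show ?thesis using that by (simp add: L2_fun_iff)
  qed
  show ?thesis
    unfolding L2_map_def
  proof (intro allI impI)
    fix h k assume hk: "(h, k) \<in> L2_rel M"
    then have [measurable]: "h \<in> borel_measurable M" "k \<in> borel_measurable M"
      using L2_relD(1,2)[OF hk] by (auto simp: L2_fun_def)
    define S where "S = {x \<in> space M. h x \<noteq> k x}"
    have S [measurable]: "S \<in> sets M" unfolding S_def by simp
    have "emeasure M S = 0"
      using L2_relD(3)[OF hk] by (subst (asm) AE_iff_measurable[OF S]) (auto simp: S_def)
    have "AE x in M. complex_of_real (sqrt D) * h (\<alpha> x) = complex_of_real (sqrt D) * k (\<alpha> x)"
    proof (cases "D = 0")
      case False
      have "ennreal D * (\<integral>\<^sup>+x. indicator S (\<alpha> x) \<partial>M) = (\<integral>\<^sup>+x. indicator S x \<partial>M)"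
        by (rule scale) simp
      also have "\<dots> = 0" using \<open>emeasure M S = 0\<close> by simp
      finally have "(\<integral>\<^sup>+x. indicator S (\<alpha> x) \<partial>M) = 0" using False D by simp
      moreover have "(\<lambda>x. indicator S (\<alpha> x) :: ennreal) \<in> borel_measurable M"
        by (rule measurable_compose[OF \<alpha>]) simp
      ultimately have "AE x in M. indicator S (\<alpha> x) = (0 :: ennreal)"
        by (simp add: nn_integral_0_iff_AE)
      then show ?thesis
        using AE_space
      proof eventually_elim
        case (elim x)
        then show ?case
          using measurable_space[OF \<alpha>, of x] by (auto simp: S_def indicator_def split: if_splits)
      qed
    qed simp
    then show "(\<lambda>x. complex_of_real (sqrt D) * h (\<alpha> x), \<lambda>x. complex_of_real (sqrt D) * k (\<alpha> x)) \<in> L2_rel M"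
      using pres L2_relD(1,2)[OF hk] by (simp add: L2_rel_def)
  qed
qed

lemma L2_map_composition:
  assumes g: "g \<in> N \<rightarrow>\<^sub>M M" and M: "distr N M g = M"
  shows "L2_map M N (\<lambda>h. h \<circ> g)" and "h \<in> L2_fun M \<Longrightarrow> (\<integral>y. (cmod ((h \<circ> g) y))\<^sup>2 \<partial>N) = (\<integral>x. (cmod (h x))\<^sup>2 \<partial>M)"
proof -
  have pres: "h \<circ> g \<in> L2_fun N" if "h \<in> L2_fun M" for h
  proof -
    have [measurable]: "h \<in> borel_measurable M" using that by (simp add: L2_fun_def)
    have "integrable (distr N M g) (\<lambda>x. (cmod (h x))\<^sup>2)"
      using that by (simp add: M L2_fun_def)
    then have "integrable N (\<lambda>x. (cmod (h (g x)))\<^sup>2)"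
      using g by (subst (asm) integrable_distr_eq) auto
    moreover have "h \<circ> g \<in> borel_measurable N"
      using g by (rule measurable_comp) simp
    ultimately show ?thesis by (simp add: L2_fun_def)
  qed
  show "L2_map M N (\<lambda>h. h \<circ> g)"
    unfolding L2_map_def
  proof (intro allI impI)
    fix h k assume hk: "(h, k) \<in> L2_rel M"
    have "AE x in distr N M g. h x = k x" using L2_relD(3)[OF hk] by (simp only: M)
    from AE_distrD[OF g this] show "(h \<circ> g, k \<circ> g) \<in> L2_rel N"
      using pres L2_relD(1,2)[OF hk] by (simp add: L2_rel_def)
  qed
  assume "h \<in> L2_fun M"
  then have "(\<lambda>x. (cmod (h x))\<^sup>2) \<in> borel_measurable M" by (auto simp: L2_fun_def)
  from integral_distr[OF g this] show "(\<integral>y. (cmod ((h \<circ> g) y))\<^sup>2 \<partial>N) = (\<integral>x. (cmod (h x))\<^sup>2 \<partial>M)"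
    by (simp add: M)
qed

locale measure_isomorphism =
  fixes M :: "'a measure" and N :: "'b measure" and f :: "'a \<Rightarrow> 'b"
  assumes iso: "bij_measure_preserving M N f"
begin

abbreviation g :: "'b \<Rightarrow> 'a" where "g \<equiv> inv_into (space M) f"

abbreviation W :: "('a \<Rightarrow> complex) \<Rightarrow> 'b \<Rightarrow> complex" where "W h \<equiv> h \<circ> g"

lemma f_measurable: "f \<in> M \<rightarrow>\<^sub>M N" and g_measurable: "g \<in> N \<rightarrow>\<^sub>M M"
  using iso by (auto simp: bij_measure_preserving_def)

lemma g_f: "x \<in> space M \<Longrightarrow> g (f x) = x" and f_g: "y \<in> space N \<Longrightarrow> f (g y) = y"
  and g_space: "y \<in> space N \<Longrightarrow> g y \<in> space M" and f_space: "x \<in> space M \<Longrightarrow> f x \<in> space N"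
  using iso measurable_space[OF g_measurable] measurable_space[OF f_measurable]
  by (auto simp: bij_measure_preserving_def bij_betw_def f_inv_into_f)

lemma distr_f: "distr M N f = N"
  using iso f_measurable
  by (intro measure_eqI) (auto simp: bij_measure_preserving_def emeasure_distr)

lemma distr_g: "distr N M g = M"
proof -
  have "distr N M g = distr (distr M N f) M g" by (simp only: distr_f)
  also have "\<dots> = distr M M (g \<circ> f)"
    by (rule distr_distr[OF g_measurable f_measurable])
  also have "\<dots> = distr M M (\<lambda>x. x)"
    by (rule distr_cong) (simp_all add: g_f)
  also have "\<dots> = M" by (rule distr_id)
  finally show ?thesis .
qed

lemmas W_L2_map = L2_map_composition(1)[OF g_measurable distr_g]
lemmas W_norm = L2_map_composition(2)[OF g_measurable distr_g]
lemmas pullback_L2_map = L2_map_composition(1)[OF f_measurable distr_f]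

lemma W_class: "h \<in> L2_fun M \<Longrightarrow> L2_op N W (L2_rel M `` {h}) = L2_rel N `` {W h}"
  by (rule L2_op_class[OF W_L2_map])

lemma W_fun: "h \<in> L2_fun M \<Longrightarrow> W h \<in> L2_fun N"
  by (rule L2_map_fun[OF W_L2_map])

lemma W_pullback:
  assumes "k \<in> L2_fun N"
  shows "(W (k \<circ> f), k) \<in> L2_rel N"
  using L2_rel_refl[OF assms] by (rule L2_rel_cong) (simp_all add: f_g)

lemma pullback_W:
  assumes "h \<in> L2_fun M"
  shows "(W h \<circ> f, h) \<in> L2_rel M"
  using L2_rel_refl[OF assms] by (rule L2_rel_cong) (simp_all add: g_f)

lemma W_bij: "bij_betw (L2_op N W) (L2 M) (L2 N)"
  unfolding bij_betw_def
proof
  show "inj_on (L2_op N W) (L2 M)"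
  proof (rule inj_onI)
    fix X Y assume "X \<in> L2 M" "Y \<in> L2 M" and eq: "L2_op N W X = L2_op N W Y"
    then obtain h k where h: "h \<in> L2_fun M" "X = L2_rel M `` {h}" and k: "k \<in> L2_fun M" "Y = L2_rel M `` {k}"
      by (metis L2_cases)
    have "(W h, W k) \<in> L2_rel N"
      using eq h k by (simp add: W_class L2_class_eq_iff W_fun)
    then have "(W h \<circ> f, W k \<circ> f) \<in> L2_rel M"
      using pullback_L2_map by (simp only: L2_map_def)
    then have "(h, k) \<in> L2_rel M"
      using pullback_W h(1) k(1) L2_rel_trans L2_rel_sym by metis
    then show "X = Y" using h k by (simp add: L2_class_eq_iff)
  qed
  show "L2_op N W ` L2 M = L2 N"
  proof (intro equalityI subsetI)
    fix Y assume "Y \<in> L2_op N W ` L2 M"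
    then obtain X where "X \<in> L2 M" and Y: "Y = L2_op N W X" by blast
    then obtain h where h: "h \<in> L2_fun M" "Y = L2_op N W (L2_rel M `` {h})"
      using L2_cases by metis
    then show "Y \<in> L2 N" using L2_class_in[OF W_fun[OF h(1)]] by (simp add: W_class)
  next
    fix Y assume "Y \<in> L2 N"
    then obtain k where k: "k \<in> L2_fun N" "Y = L2_rel N `` {k}" by (rule L2_cases)
    have kf: "k \<circ> f \<in> L2_fun M" by (rule L2_map_fun[OF pullback_L2_map k(1)])
    then have "L2_op N W (L2_rel M `` {k \<circ> f}) = Y"
      using W_pullback[OF k(1)] k by (simp add: W_class L2_class_eq_iff W_fun)
    then show "Y \<in> L2_op N W ` L2 M"
      using L2_class_in[OF kf] by blast
  qed
qed

lemma W_isometric_iso: "L2_isometric_iso M N (L2_op N W)"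
  unfolding L2_isometric_iso_def
proof (intro conjI ballI allI W_bij)
  fix X assume "X \<in> L2 M"
  then obtain h where h: "h \<in> L2_fun M" "X = L2_rel M `` {h}" by (rule L2_cases)
  show "L2_norm N (L2_op N W X) = L2_norm M X"
    using h W_norm[OF h(1)] by (simp only: W_class L2_norm_class W_fun)
  show "L2_op N W (L2_scale M c X) = L2_scale N c (L2_op N W X)" for c
    using h by (simp add: W_class L2_scale_class W_fun L2_fun_scale) (simp add: o_def)
  fix Y assume "Y \<in> L2 M"
  then obtain k where k: "k \<in> L2_fun M" "Y = L2_rel M `` {k}" by (rule L2_cases)
  show "L2_op N W (L2_add M X Y) = L2_add N (L2_op N W X) (L2_op N W Y)"
    using h k by (simp add: W_class L2_add_class W_fun L2_fun_add) (simp add: o_def)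
qed

text \<open>The pointwise relation between \<open>T\<close> and \<open>T'\<close> says that \<open>T'\<close> is \<open>T\<close> conjugated by \<open>W\<close>; that \<open>T'\<close>
  acts on classes is inherited from \<open>T\<close>.\<close>

lemma W_intertwines:
  assumes T: "L2_map M M T"
    and conj: "\<And>k x. x \<in> space M \<Longrightarrow> T' k (f x) = T (k \<circ> f) x"
    and F: "F \<in> L2 M"
  shows "L2_op N W (L2_op M T F) = L2_op N T' (L2_op N W F)"
proof -
  have T'_eq: "T' k y = W (T (k \<circ> f)) y" if "y \<in> space N" for k y
    using conj[OF g_space[OF that], of k] by (simp add: f_g that)
  have T': "L2_map N N T'"
    unfolding L2_map_def
  proof (intro allI impI)
    fix h k assume "(h, k) \<in> L2_rel N"
    then have "(W (T (h \<circ> f)), W (T (k \<circ> f))) \<in> L2_rel N"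
      using T W_L2_map pullback_L2_map unfolding L2_map_def by blast
    then show "(T' h, T' k) \<in> L2_rel N"
      by (rule L2_rel_cong) (simp_all add: T'_eq)
  qed
  obtain h where h: "h \<in> L2_fun M" "F = L2_rel M `` {h}" using F by (rule L2_cases)
  have Th: "T h \<in> L2_fun M" by (rule L2_map_fun[OF T h(1)])
  have "(W (T (W h \<circ> f)), W (T h)) \<in> L2_rel N"
    using pullback_W[OF h(1)] T W_L2_map unfolding L2_map_def by blast
  then have "(T' (W h), W (T h)) \<in> L2_rel N"
    by (rule L2_rel_cong) (simp_all add: T'_eq)
  then have "L2_rel N `` {W (T h)} = L2_rel N `` {T' (W h)}"
    using L2_class_eq_iff L2_rel_sym L2_relD by metis
  then show ?thesis
    using h Th by (simp add: L2_op_class[OF T] L2_op_class[OF T'] W_class W_fun)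
qed

end

section \<open>Linear change of variables\<close>

text \<open>A translation along the coordinate \<open>n\<close> moves the lower corner of the box to zero in that
  coordinate, where \<open>measure_shear_interval\<close> applies; translations preserve volume.\<close>

lemma measure_shear_image:
  fixes m n :: "'n::finite"
  assumes "m \<noteq> n" 
  defines "f \<equiv> \<lambda>x :: real^'n. \<chi> i. if i = m then x $ m + x $ n else x $ i"
  shows "measure lebesgue (f ` cbox a b) = measure lebesgue (cbox a b)"
proof (cases "cbox a b = {}")
  case False
  define c where "c = axis n (a $ n)"
  have lin: "linear f"
    unfolding f_def by (rule linearI) (auto simp: vec_eq_iff algebra_simps)
  have "f ` (cbox a b) = (+) (f c) ` f ` cbox (a - c) (b - c)"
  proof -
    have "cbox a b = (+) c ` cbox (a - c) (b - c)"
      by (simp flip: cbox_translation)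
    then show ?thesis
      by (auto simp: image_image linear_add[OF lin])
  qed
  then have "measure lebesgue (f ` cbox a b) = measure lebesgue (f ` cbox (a - c) (b - c))"
    by (simp add: measure_translation)
  also have "\<dots> = measure lebesgue (cbox (a - c) (b - c))"
    unfolding f_def
  proof (rule measure_shear_interval[OF assms(1)])
    show "cbox (a - c) (b - c) \<noteq> {}"
      using False by (simp add: interval_ne_empty_cart)
  qed (simp add: c_def)
  also have "\<dots> = measure lebesgue ((+) c ` cbox (a - c) (b - c))"
    by (simp add: measure_translation)
  finally show ?thesis by (simp flip: cbox_translation)
qed simp

lemma measure_swap_image:
  fixes m n :: "'n::finite"
  defines "f \<equiv> \<lambda>x :: real^'n. \<chi> i. x $ Transposition.transpose m n i"
  shows "measure lebesgue (f ` cbox a b) = measure lebesgue (cbox a b)"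
proof (cases "cbox a b = {}")
  case False
  have inv: "f (f x) = x" for x
    by (simp add: f_def vec_eq_iff)
  have box: "f x \<in> cbox (f u) (f v)" if "x \<in> cbox u v" for x u v
    using that by (simp add: f_def mem_box_cart)
  have eq: "f ` cbox a b = cbox (f a) (f b)"
  proof (intro equalityI subsetI)
    fix y assume "y \<in> cbox (f a) (f b)"
    then have "f y \<in> cbox a b" using box[of y "f a" "f b"] by (simp only: inv)
    then show "y \<in> f ` cbox a b" by (intro image_eqI[of _ _ "f y"]) (simp_all only: inv)
  qed (use box in blast)
  then have "cbox (f a) (f b) \<noteq> {}" using False by auto
  then have "measure lebesgue (f ` cbox a b) = (\<Prod>i\<in>UNIV. (b - a) $ Transposition.transpose m n i)"
    by (simp add: eq content_cbox_cart) (simp add: f_def)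
  also have "\<dots> = (\<Prod>i\<in>UNIV. (b - a) $ i)"
    by (rule prod.permute[OF permutes_swap_id, symmetric, unfolded o_def]) auto
  finally show ?thesis using False by (simp add: content_cbox_cart)
qed simp

text \<open>Both the volume factor and \<open>\<bar>det\<bar>\<close> are multiplicative, so it is enough to treat scalings of the
  coordinates, transpositions and shears. Maps with a zero row drop out of the induction since
  their determinant vanishes.\<close>

lemma measure_linear_image_det:
  fixes f :: "real^'n \<Rightarrow> real^'n"
  assumes "linear f" 
  shows "det (matrix f) \<noteq> 0 \<longrightarrow> (\<forall>S\<in>lmeasurable. f ` S \<in> lmeasurable \<and>
      measure lebesgue (f ` S) = \<bar>det (matrix f)\<bar> * measure lebesgue S)"
    (is "?P f")
  using assms
proof (rule induct_linear_elementary)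
  fix f g :: "real^'n \<Rightarrow> real^'n"
  assume lin: "linear f" "linear g" and P: "?P f" "?P g"
  have "det (matrix (f \<circ> g)) = det (matrix f) * det (matrix g)"
    using lin by (simp add: matrix_compose det_mul)
  moreover have "(f \<circ> g) ` S = f ` g ` S" for S by (rule image_comp[symmetric])
  ultimately show "?P (f \<circ> g)"
    using P by (simp only:) (simp add: abs_mult)
next
  fix f :: "real^'n \<Rightarrow> real^'n" and i
  assume "\<And>x. f x $ i = 0"
  then have "row i (matrix f) = 0" by (simp add: row_def matrix_def vec_eq_iff)
  then show "?P f" by (simp add: det_zero_row)
next
  fix c :: "'n \<Rightarrow> real"
  show "?P (\<lambda>x. \<chi> i. c i * x $ i)"
    by (simp add: measurable_stretch measure_stretch det_diagonal matrix_def axis_def)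
next
  fix m n :: 'n assume "m \<noteq> n"
  let ?f = "\<lambda>x :: real^'n. \<chi> i. x $ Transposition.transpose m n i"
  have lin: "linear ?f" by (rule linearI) (simp_all add: vec_eq_iff)
  have "matrix ?f = (\<chi> i. mat 1 $ Transposition.transpose m n i)"
    by (auto simp: vec_eq_iff matrix_def mat_def axis_def)
  then have det: "\<bar>det (matrix ?f)\<bar> = 1"
    using \<open>m \<noteq> n\<close> by (simp add: det_permute_rows permutes_swap_id sign_swap_id)
  have image: "?f ` S \<in> lmeasurable \<and> 1 * measure lebesgue S = measure lebesgue (?f ` S)"
    if "S \<in> lmeasurable" for S
    by (rule measure_linear_sufficient[OF lin that]) (simp only: measure_swap_image mult_1)
  show "?P ?f"
    unfolding det
  proof (intro impI ballI conjI)
    fix S :: "(real^'n) set" assume S: "S \<in> lmeasurable"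
    show "?f ` S \<in> lmeasurable" by (rule conjunct1[OF image[OF S]])
    show "measure lebesgue (?f ` S) = 1 * measure lebesgue S"
      by (rule conjunct2[OF image[OF S], symmetric])
  qed
next
  fix m n :: 'n assume "m \<noteq> n"
  let ?f = "\<lambda>x :: real^'n. \<chi> i. if i = m then x $ m + x $ n else x $ i"
  have lin: "linear ?f" by (rule linearI) (auto simp: vec_eq_iff algebra_simps)
  have "matrix ?f = (\<chi> k. if k = m then row m (mat 1) + 1 *s row n (mat 1) else row k (mat 1))"
    by (auto simp: vec_eq_iff matrix_def mat_def axis_def row_def)
  then have det: "\<bar>det (matrix ?f)\<bar> = 1"
    using det_row_operation[OF \<open>m \<noteq> n\<close>, of "mat 1 :: real^'n^'n" 1] by simp
  have image: "?f ` S \<in> lmeasurable \<and> 1 * measure lebesgue S = measure lebesgue (?f ` S)"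
    if "S \<in> lmeasurable" for S
    by (rule measure_linear_sufficient[OF lin that])
       (simp only: measure_shear_image[OF \<open>m \<noteq> n\<close>] mult_1)
  show "?P ?f"
    unfolding det
  proof (intro impI ballI conjI)
    fix S :: "(real^'n) set" assume S: "S \<in> lmeasurable"
    show "?f ` S \<in> lmeasurable" by (rule conjunct1[OF image[OF S]])
    show "measure lebesgue (?f ` S) = 1 * measure lebesgue S"
      by (rule conjunct2[OF image[OF S], symmetric])
  qed
qed
text \<open>The preimage of a box under \<open>M\<close> is its image under the inverse, so the push-forward of Lebesgue
  measure is a multiple of Lebesgue measure on boxes, and hence everywhere.\<close>

lemma nn_integral_lborel_linear:
  fixes M :: "real^'n^'n"
  assumes M: "invertible M" and g: "g \<in> borel_measurable borel"
  shows "ennreal \<bar>det M\<bar> * (\<integral>\<^sup>+x. g (M *v x) \<partial>lborel) = (\<integral>\<^sup>+x. g x \<partial>lborel)"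
proof -
  let ?N = "matrix_inv M"
  have inv: "M *v (?N *v x) = x" "?N *v (M *v x) = x" for x
    by (simp_all only: matrix_vector_mul_assoc matrix_inv_mult[OF M] matrix_vector_mul_lid)
  have det: "\<bar>det M\<bar> * \<bar>det ?N\<bar> = 1"
    using det_mul[of M ?N] by (simp add: matrix_inv_mult[OF M] flip: abs_mult)
  have meas: "(*v) M \<in> borel \<rightarrow>\<^sub>M borel"
    by (intro borel_measurable_continuous_onI linear_continuous_on matrix_vector_mul_bounded_linear)
  have "lborel = scale_measure (ennreal \<bar>det M\<bar>) (distr lborel borel ((*v) M))" (is "_ = ?D")
  proof (rule lborel_eqI)
    fix l u :: "real^'n"
    assume lu: "\<And>b. b \<in> Basis \<Longrightarrow> l \<bullet> b \<le> u \<bullet> b"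
    let ?S = "(*v) ?N ` box l u"
    have S: "(*v) M -` box l u = ?S"
      by (auto simp: inv image_iff intro: inv(2)[symmetric])
    have S_borel: "?S \<in> sets lborel"
      using measurable_sets[OF meas, of "box l u"] by (simp add: S)
    have image: "?S \<in> lmeasurable \<and> measure lebesgue ?S = \<bar>det ?N\<bar> * measure lebesgue (box l u)"
    proof -
      have "det ?N \<noteq> 0" using det by auto
      then show ?thesis
        using measure_linear_image_det[OF matrix_vector_mul_linear, of ?N] by auto
    qed
    have "emeasure lborel ?S = emeasure lebesgue ?S"
      using S_borel by (simp only: emeasure_completion[OF sets_completionI_sets] main_part[OF S_borel])
    also have "\<dots> = ennreal (measure lebesgue ?S)"
      using image by (intro emeasure_eq_measure2) blast
    also have "measure lebesgue ?S = \<bar>det ?N\<bar> * measure lebesgue (box l u)"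
      using image by simp
    also have "measure lebesgue (box l u) = (\<Prod>b\<in>Basis. (u - l) \<bullet> b)"
      using lu by simp
    finally have "emeasure lborel ?S = ennreal (\<bar>det ?N\<bar> * (\<Prod>b\<in>Basis. (u - l) \<bullet> b))" .
    then have "emeasure ?D (box l u) = ennreal \<bar>det M\<bar> * ennreal (\<bar>det ?N\<bar> * (\<Prod>b\<in>Basis. (u - l) \<bullet> b))"
      using meas by (simp add: emeasure_distr S)
    also have "\<dots> = ennreal (\<Prod>b\<in>Basis. (u - l) \<bullet> b)"
      by (simp add: det flip: ennreal_mult' mult.assoc)
    finally show "emeasure ?D (box l u) = ennreal (\<Prod>b\<in>Basis. (u - l) \<bullet> b)" .
  qed simp
  then have "(\<integral>\<^sup>+x. g x \<partial>lborel) = (\<integral>\<^sup>+x. g x \<partial>?D)" by simp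
  also have "\<dots> = ennreal \<bar>det M\<bar> * (\<integral>\<^sup>+x. g (M *v x) \<partial>lborel)"
    using meas g by (subst nn_integral_scale_measure) (simp_all add: nn_integral_distr)
  finally show ?thesis by simp
qed

section \<open>Intertwining of the operators\<close>

lemma det_real_mat: "det (real_mat A) = real_of_int (det A)"
  by (simp add: det_def real_mat_def)

context solenoid_cycle
begin

lemma bij_betw_pred_mod: "bij_betw (pred_mod p) {..<p} {..<p}"
proof -
  have "pred_mod p ` {..<p} \<subseteq> {..<p}"
    using p_pos by (auto simp: pred_mod_def)
  moreover have "inj_on (pred_mod p) {..<p}"
  proof (rule inj_onI)
    fix j k assume "j \<in> {..<p}" "k \<in> {..<p}" "pred_mod p j = pred_mod p k"
    then show "j = k" using Suc_pred_mod[of 0 j] Suc_pred_mod[of 0 k] by simp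
  qed
  ultimately show ?thesis
    by (simp add: bij_betw_def endo_inj_surj)
qed

lemma alpha_measurable: "alpha A p \<in> leb_count p \<rightarrow>\<^sub>M leb_count p"
proof (rule measurable_leb_count)
  fix j assume "j < p"
  then have "pred_mod p j \<in> {..<p}" using bij_betw_pred_mod by (auto simp: bij_betw_def)
  moreover have "(*v) B \<in> borel \<rightarrow>\<^sub>M borel"
    by (intro borel_measurable_continuous_onI linear_continuous_on matrix_vector_mul_bounded_linear)
  ultimately show "(\<lambda>x. alpha A p (x, j)) \<in> borel \<rightarrow>\<^sub>M leb_count p"
    unfolding alpha_def leb_count_def by (simp del: transpose_matrix_vector)
qed

lemma alpha_dilates:
  assumes g: "g \<in> borel_measurable (leb_count p)"
  shows "ennreal \<bar>det B\<bar> * (\<integral>\<^sup>+s. g (alpha A p s) \<partial>leb_count p) = (\<integral>\<^sup>+s. g s \<partial>leb_count p)"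
proof -
  have "(\<integral>\<^sup>+s. g (alpha A p s) \<partial>leb_count p) = (\<Sum>j<p. \<integral>\<^sup>+x. g (B *v x, pred_mod p j) \<partial>lborel)"
    using measurable_compose[OF alpha_measurable g]
    by (subst nn_integral_leb_count) (simp_all add: alpha_def)
  then have "ennreal \<bar>det B\<bar> * (\<integral>\<^sup>+s. g (alpha A p s) \<partial>leb_count p)
      = (\<Sum>j<p. ennreal \<bar>det B\<bar> * (\<integral>\<^sup>+x. g (B *v x, pred_mod p j) \<partial>lborel))"
    by (simp only: sum_distrib_left)
  also have "\<dots> = (\<Sum>j<p. \<integral>\<^sup>+x. g (x, pred_mod p j) \<partial>lborel)"
  proof (rule sum.cong[OF refl])
    fix j assume "j \<in> {..<p}"
    then have "pred_mod p j < p" using bij_betw_pred_mod by (auto simp: bij_betw_def)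
    then show "ennreal \<bar>det B\<bar> * (\<integral>\<^sup>+x. g (B *v x, pred_mod p j) \<partial>lborel)
        = (\<integral>\<^sup>+x. g (x, pred_mod p j) \<partial>lborel)"
      by (intro nn_integral_lborel_linear[OF expansive_invertible[OF expansive], of "\<lambda>x. g (x, pred_mod p j)"]
          measurable_leb_count_section[OF g])
  qed
  also have "\<dots> = (\<Sum>j<p. \<integral>\<^sup>+x. g (x, j) \<partial>lborel)"
    by (rule sum.reindex_bij_betw[OF bij_betw_pred_mod])
  also have "\<dots> = (\<integral>\<^sup>+s. g s \<partial>leb_count p)"
    by (rule nn_integral_leb_count[OF g, symmetric])
  finally show ?thesis .
qed

lemma hat_T_C_L2_map: "L2_map (leb_count p) (leb_count p) (hat_T_C \<zeta> k)"
proof -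
  \<comment> \<open>The operator is multiplication by this unimodular function.\<close>
  define m where "m = (\<lambda>(x, j). torus_pow (\<zeta> j) k * cis (2 * pi * int_inner k x))"
  have "hat_T_C \<zeta> k = (\<lambda>h s. m s * h s)"
    by (simp add: fun_eq_iff hat_T_C_def hat_T_def m_def)
  moreover have "L2_map (leb_count p) (leb_count p) (\<lambda>h s. m s * h s)"
  proof (rule L2_map_unimodular)
    have "continuous_on UNIV (\<lambda>x. m (x, j))" for j
      unfolding m_def int_inner_def cis_conv_exp by (simp only: prod.case) (intro continuous_intros)
    then show "m \<in> borel_measurable (leb_count p)"
      by (intro measurable_leb_count borel_measurable_continuous_onI)
    show "cmod (m s) = 1" if "s \<in> space (leb_count p)" for s
      using that by (auto simp: space_leb_count m_def norm_mult \<zeta>_eq torus_pow_e2pi)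
  qed
  ultimately show ?thesis by simp
qed

lemma hat_U_C_eq: "hat_U_C A p = (\<lambda>h s. complex_of_real (sqrt \<bar>det B\<bar>) * h (alpha A p s))"
  by (simp add: fun_eq_iff hat_U_C_def hat_U_def alpha_def det_transpose det_real_mat)

lemma hat_U_C_L2_map: "L2_map (leb_count p) (leb_count p) (hat_U_C A p)"
  unfolding hat_U_C_eq by (rule L2_map_dilation[OF alpha_measurable _ alpha_dilates]) simp

lemma tilde_T_\<iota>:
  assumes "j < p"
  shows "tilde_T k f (\<iota> (x, j)) = hat_T_C \<zeta> k (f \<circ> \<iota>) (x, j)"
proof -
  have "int_inner k (x + \<theta> j) = int_inner k x + int_inner k (\<theta> j)"
    by (simp add: int_inner_def distrib_left sum.distrib)
  moreover have "\<iota> (x, j) 0 = e2pi (x + \<theta> j)"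
    using assms by (simp add: \<iota>_eq e2pi_add \<zeta>_eq)
  ultimately have "torus_pow (\<iota> (x, j) 0) k = torus_pow (\<zeta> j) k * cis (2 * pi * int_inner k x)"
    using assms by (simp add: torus_pow_e2pi \<zeta>_eq cis_mult algebra_simps)
  then show ?thesis
    by (simp add: tilde_T_def hat_T_C_def hat_T_def)
qed

lemma tilde_U_\<iota>: "tilde_U A f (\<iota> (x, j)) = hat_U_C A p (f \<circ> \<iota>) (x, j)"
  unfolding tilde_U_def hat_U_C_eq sigma_\<iota> by (simp add: det_transpose det_real_mat)

end

context periodic_solenoid_cycle
begin

sublocale measure_isomorphism "leb_count p" "mu_tilde A p \<zeta>" \<iota>
  by unfold_locales (rule \<iota>_measure_preserving)

lemma W_C_eq: "W_C A p \<zeta> = W"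
  by (simp add: fun_eq_iff W_C_def space_leb_count)

lemma W_C_isometric_iso: "L2_isometric_iso (leb_count p) (mu_tilde A p \<zeta>) (L2_op (mu_tilde A p \<zeta>) (W_C A p \<zeta>))"
  unfolding W_C_eq by (rule W_isometric_iso)

lemma W_C_hat_T_C:
  assumes "F \<in> L2 (leb_count p)"
  shows "L2_op (mu_tilde A p \<zeta>) (W_C A p \<zeta>) (L2_op (leb_count p) (hat_T_C \<zeta> k) F)
    = L2_op (mu_tilde A p \<zeta>) (tilde_T k) (L2_op (mu_tilde A p \<zeta>) (W_C A p \<zeta>) F)"
  unfolding W_C_eq using assms
  by (rule W_intertwines[OF hat_T_C_L2_map, rotated]) (auto simp: space_leb_count tilde_T_\<iota>)

lemma W_C_hat_U_C:
  assumes "F \<in> L2 (leb_count p)"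
  shows "L2_op (mu_tilde A p \<zeta>) (W_C A p \<zeta>) (L2_op (leb_count p) (hat_U_C A p) F)
    = L2_op (mu_tilde A p \<zeta>) (tilde_U A) (L2_op (mu_tilde A p \<zeta>) (W_C A p \<zeta>) F)"
  unfolding W_C_eq using assms
  by (rule W_intertwines[OF hat_U_C_L2_map, rotated]) (auto simp: space_leb_count tilde_U_\<iota>)

end

theorem theorem4p9:
  fixes A :: "int^'d^'d" and p :: nat
    and \<zeta> :: "nat \<Rightarrow> complex^'d" and \<theta> :: "nat \<Rightarrow> real^'d"
  assumes "expansive A"
    and "is_cycle A p \<zeta>"
    and "\<And>j. j < p \<Longrightarrow> \<zeta> j = e2pi (\<theta> j)"
  shows
    "((sigma_A A ^^ p) (chi_C p \<zeta>) = chi_C p \<zeta> \<and>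
      (\<forall>j<p. sigma_A A ` leaf_C A p \<zeta> j = leaf_C A p \<zeta> (pred_mod p j))) \<and>
     solenoid_C A p \<zeta> = {z \<in> solenoid A. (\<lambda>n. infdist (z n) (\<zeta> ` {..<p})) \<longlonglongrightarrow> 0} \<and>
     ((inj_on \<zeta> {..<p} \<longrightarrow> bij_measure_preserving (leb_count p) (mu_tilde A p \<zeta>) (hat_i_C A p \<zeta>)) \<and>
      (\<forall>x. \<forall>j<p. hat_i_C A p \<zeta> (alpha A p (x, j)) = sigma_A A (hat_i_C A p \<zeta> (x, j)))) \<and>
     (inj_on \<zeta> {..<p} \<longrightarrow>
        L2_isometric_iso (leb_count p) (mu_tilde A p \<zeta>) (L2_op (mu_tilde A p \<zeta>) (W_C A p \<zeta>)) \<and>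
        (\<forall>k. \<forall>F\<in>L2 (leb_count p). L2_op (mu_tilde A p \<zeta>) (W_C A p \<zeta>) (L2_op (leb_count p) (hat_T_C \<zeta> k) F)
                     = L2_op (mu_tilde A p \<zeta>) (tilde_T k) (L2_op (mu_tilde A p \<zeta>) (W_C A p \<zeta>) F)) \<and>
        (\<forall>F\<in>L2 (leb_count p). L2_op (mu_tilde A p \<zeta>) (W_C A p \<zeta>) (L2_op (leb_count p) (hat_U_C A p) F)
                  = L2_op (mu_tilde A p \<zeta>) (tilde_U A) (L2_op (mu_tilde A p \<zeta>) (W_C A p \<zeta>) F)))"
proof -
  interpret solenoid_cycle A p \<zeta> \<theta>
    by unfold_locales (use assms in auto)
  have periodic: "periodic_solenoid_cycle A p \<zeta> \<theta>" if "inj_on \<zeta> {..<p}"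
    by unfold_locales (rule that)
  show ?thesis
    using sigma_power_chi sigma_leaf \<Omega>_eq_asymptotic sigma_\<iota>
      periodic_solenoid_cycle.\<iota>_measure_preserving[OF periodic]
      periodic_solenoid_cycle.W_C_isometric_iso[OF periodic]
      periodic_solenoid_cycle.W_C_hat_T_C[OF periodic]
      periodic_solenoid_cycle.W_C_hat_U_C[OF periodic]
    by (intro conjI allI impI ballI) simp_all
qed

end
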